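(* Consider a new seller in the E-commerce reputation model described in the context, who advertises honestly. The long term expected profit gains for the new seller can be expressed as $$\begin{aligned} G_s ={}& \sum_{k=0}^{r_h-1} \frac{(\lambda_1P_{ba}T_w)^k}{k!}e^{-\lambda_1P_{ba}T_w}\int\limits_{0<t_1<\cdots<t_k<T_w}\frac{k!}{T_w^k}\sum_{j=1}^k u\,\delta^{\lceil t_j/d\rceil}\,dt_1\cdots dt_k\\ &+\int_0^{T_w} dt_{r_h}\int\limits_{0<t_1<\cdots<t_{r_h-1}<t_{r_h}}\lambda_1P_{ba}\,e^{-\lambda_1P_{ba} t_{r_h}}\frac{(\lambda_1P_{ba} t_{r_h})^{r_h-1}}{(r_h-1)!}\,\frac{(r_h-1)!}{(t_{r_h})^{r_h-1}}\,u\,\Bigg(\sum_{j=1}^{r_h}\delta^{\lceil t_j/d\rceil}+\lambda_2P_{br}\,d\,\frac{\delta^{\lceil t_{r_h}/d\rceil+1}}{1-\delta}\\ &\qquad\qquad+\delta^{\lceil t_{r_h}/d\rceil}\,\lambda_1P_{ba}\,\big(d\lceil t_{r_h}/d\rceil-t_{r_h}\big)\Bigg)dt_1\cdots dt_{r_h-1}. \end{aligned}$$ Furthermore, the average per seller transaction gains of the operator are $G_e=\frac{\alpha p}{u}G_s$.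
   Context: Time is divided into slots; slot $\tau\in\{0,1,2,\ldots\}$ is the interval $[\tau d,(\tau+1)d)$, where $d$ is the shipment delay. A buyer's payment is submitted to the operator at purchase and is given to the seller when the buyer receives the product. A seller has an integer reputation score $r(\tau)$ in slot $\tau$, with $r(0)=0$. Let $N(\tau)$ be the number of products sold (transactions) in slot $\tau$. The seller is honest (advertised quality equals intrinsic quality $Q_i\in[0,1]$), so every transaction yields a positive feedback $+1$, and $r(\tau+1)=r(\tau)+N(\tau)$. The positive integer $r_h$ is the reputation threshold. A seller is labeled reputable if $r\ge r_h$ and the fraction of positive feedbacks is at least a given $\theta\in(0,1]$ (automatic for an honest seller), and is labeled average otherwise. Buyers arrive according to a Poisson process with rate $\lambda_1$ during slots with $r(\tau)<r_h$ and rate $\lambda_2>\lambda_1$ during slots with $r(\tau)\ge r_h$. An arriving buyer buys a product with probability $P_{ba}=\mathcal{P}(\beta Q_i,p)$ if the seller is labeled average and $P_{br}=\mathcal{P}(Q_i,p)$ if labeled reputable, where $\mathcal{P}(Q,p)$ is a probability that increases in the estimated quality $Q$ and decreases in the price $p$, and $\beta\in[0,1]$ is a discounting factor. Hence transactions in slot $\tau$ arrive as a Poisson process with rate $\lambda_1P_{ba}$ if $r(\tau)<r_h$ and rate $\lambda_2P_{br}$ if $r(\tau)\ge r_h$. The ramp up time is $T_r=d\cdot\min\{\tau: r(\tau)\ge r_h\}$. The maximum time the seller is willing to wait to ramp up is $T_w>0$, with $T_w/d\in\mathbb{N}$: if $T_r>T_w$ the seller drops out, and there are no transactions from slot $T_w/d$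 on. Each product has price $p\in[0,1]$ and manufacturing cost $c\in[0,1]$; the operator charges a transaction fee $\alpha p$, $\alpha\in(0,1)$, per sold product; the unit profit is $u=(1-\alpha)p-c$. With a discounting factor $\delta\in(0,1]$, the long term expected profit gains for the seller and the average per seller transaction gains for the operator are defined as $$G_s=E\Big[\sum_{\tau=0}^\infty\delta^{\tau}u\,N(\tau)\Big],\qquad G_e=E\Big[\sum_{\tau=0}^\infty\delta^{\tau}\alpha p\,N(\tau)\Big].$$
   Formalization: The printed right-hand side equals δ·G_s when slot τ is discounted by δ^τ, so the formal statement multiplies it by 1/δ; the formula for G_s is stated for δ<1 (1/(1−δ) is undefined at δ=1), and G_e=(αp/u)G_s for u≠0. *)

theory Defs
  imports "HOL-Probability.Probability"
begin

text \<open>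
  A random set of time instants is a map from outcomes to sets of reals. Throughout, \<open>B \<omega>\<close> is the
  set of instants at which buyers arrive and \<open>S \<omega> \<subseteq> B \<omega>\<close> the set of those arrivals that
  end in a purchase, i.e. the transactions of the seller.
\<close>

definition points_in :: "('a \<Rightarrow> real set) \<Rightarrow> real \<Rightarrow> real \<Rightarrow> 'a \<Rightarrow> nat" where
  "points_in X s t \<omega> = card (X \<omega> \<inter> {s..<t})"

definition transactions :: "('a \<Rightarrow> real set) \<Rightarrow> real \<Rightarrow> nat \<Rightarrow> 'a \<Rightarrow> nat" where
  "transactions S d \<tau> = points_in S (real \<tau> * d) (real (Suc \<tau>) * d)"

text \<open>The seller is honest: each transaction contributes a feedback \<open>+1\<close>.\<close>

primrec reputation :: "('a \<Rightarrow> real set) \<Rightarrow> real \<Rightarrow> nat \<Rightarrow> 'a \<Rightarrow> int" where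
  "reputation S d 0 \<omega> = 0"
| "reputation S d (Suc \<tau>) \<omega> = reputation S d \<tau> \<omega> + int (transactions S d \<tau> \<omega>)"

definition feedbacks :: "('a \<Rightarrow> real set) \<Rightarrow> real \<Rightarrow> nat \<Rightarrow> 'a \<Rightarrow> nat" where
  "feedbacks S d \<tau> \<omega> = (\<Sum>i<\<tau>. transactions S d i \<omega>)"

definition labeled_reputable :: "nat \<Rightarrow> real \<Rightarrow> int \<Rightarrow> nat \<Rightarrow> nat \<Rightarrow> bool" where
  "labeled_reputable r_h \<theta> r n_pos n_all \<longleftrightarrow>
     int r_h \<le> r \<and> \<theta> \<le> real n_pos / real n_all"

definition ramp_up_time :: "('a \<Rightarrow> real set) \<Rightarrow> real \<Rightarrow> nat \<Rightarrow> 'a \<Rightarrow> ereal" where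
  "ramp_up_time S d r_h \<omega> =
     (if \<exists>\<tau>. int r_h \<le> reputation S d \<tau> \<omega>
      then ereal (d * real (LEAST \<tau>. int r_h \<le> reputation S d \<tau> \<omega>)) else \<infinity>)"

definition dropped_out :: "('a \<Rightarrow> real set) \<Rightarrow> real \<Rightarrow> nat \<Rightarrow> real \<Rightarrow> nat \<Rightarrow> 'a \<Rightarrow> bool" where
  "dropped_out S d r_h T_w \<tau> \<omega> \<longleftrightarrow>
     ereal T_w < ramp_up_time S d r_h \<omega> \<and> T_w / d \<le> real \<tau>"

definition arrival_rate ::
  "('a \<Rightarrow> real set) \<Rightarrow> real \<Rightarrow> nat \<Rightarrow> real \<Rightarrow> real \<Rightarrow> nat \<Rightarrow> 'a \<Rightarrow> real" where
  "arrival_rate S d r_h lam1 lam2 \<tau> \<omega> =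
     (if reputation S d \<tau> \<omega> < int r_h then lam1 else lam2)"

text \<open>For an honest seller all feedbacks are positive, so both counts in the label coincide.\<close>

definition purchase_prob ::
  "('a \<Rightarrow> real set) \<Rightarrow> real \<Rightarrow> nat \<Rightarrow> real \<Rightarrow> real \<Rightarrow> real \<Rightarrow> real \<Rightarrow> nat \<Rightarrow> 'a \<Rightarrow> real" where
  "purchase_prob S d r_h \<theta> T_w P_ba P_br \<tau> \<omega> =
     (if dropped_out S d r_h T_w \<tau> \<omega> then 0
      else if labeled_reputable r_h \<theta> (reputation S d \<tau> \<omega>)
                (feedbacks S d \<tau> \<omega>) (feedbacks S d \<tau> \<omega>)
      then P_br else P_ba)"

text \<open>The events determined by the arrivals and transactions strictly before time \<open>s\<close>.\<close>

definition history ::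
  "'a measure \<Rightarrow> ('a \<Rightarrow> real set) \<Rightarrow> ('a \<Rightarrow> real set) \<Rightarrow> real \<Rightarrow> 'a measure" where
  "history M B S s = sigma (space M)
     ({{\<omega> \<in> space M. points_in B 0 w \<omega> = n} | w n. w \<le> s} \<union>
      {{\<omega> \<in> space M. points_in S 0 w \<omega> = n} | w n. w \<le> s})"

text \<open>
  The dynamics: for a time interval \<open>[s, t)\<close> inside slot \<open>\<tau>\<close>, conditionally on the history up to
  \<open>s\<close> the number of arriving buyers is Poisson with the arrival rate of the slot, and each of them
  buys independently with the purchase probability of the slot. Rate and probability depend only on
  the reputation at the slots up to \<open>\<tau>\<close>, hence on the history. As the condition holds for all
  subintervals and histories, the arrivals form, within each slot and given its past, a Poisson
  process with independent marks.
\<close>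

locale honest_seller = prob_space M for M :: "'a measure" +
  fixes B S :: "'a \<Rightarrow> real set" and d :: real and r_h :: nat
    and \<theta> T_w lam1 lam2 P_ba P_br :: real
  assumes transactions_subset_arrivals: "\<And>\<omega>. \<omega> \<in> space M \<Longrightarrow> S \<omega> \<subseteq> B \<omega>"
    and arrivals_nonneg: "\<And>\<omega>. \<omega> \<in> space M \<Longrightarrow> B \<omega> \<subseteq> {0..}"
    and arrivals_locally_finite: "\<And>\<omega> t. \<omega> \<in> space M \<Longrightarrow> finite (B \<omega> \<inter> {0..<t})"
    and arrivals_measurable: "\<And>t. points_in B 0 t \<in> M \<rightarrow>\<^sub>M count_space UNIV"
    and transactions_measurable: "\<And>t. points_in S 0 t \<in> M \<rightarrow>\<^sub>M count_space UNIV"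
    and conditional_law:
      "\<And>\<tau> s t A n k. real \<tau> * d \<le> s \<Longrightarrow> s < t \<Longrightarrow> t \<le> real (Suc \<tau>) * d \<Longrightarrow>
         A \<in> sets (history M B S s) \<Longrightarrow>
         prob (A \<inter> {\<omega> \<in> space M. points_in B s t \<omega> = n \<and> points_in S s t \<omega> = k}) =
         (LINT \<omega>:A|M.
            pmf (poisson_pmf (arrival_rate S d r_h lam1 lam2 \<tau> \<omega> * (t - s))) n *
            pmf (binomial_pmf n (purchase_prob S d r_h \<theta> T_w P_ba P_br \<tau> \<omega>)) k)"

text \<open>
  Expectation with values in the extended reals, so that the gains are also meaningful without
  discounting, where the series may diverge.
\<close>

definition extended_expectation :: "'a measure \<Rightarrow> ('a \<Rightarrow> ereal) \<Rightarrow> ereal" where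
  "extended_expectation M X =
     enn2ereal (\<integral>\<^sup>+ \<omega>. e2ennreal (X \<omega>) \<partial>M) - enn2ereal (\<integral>\<^sup>+ \<omega>. e2ennreal (- X \<omega>) \<partial>M)"

text \<open>The expected discounted gain of a party that earns \<open>g\<close> per transaction.\<close>

definition expected_gain ::
  "'a measure \<Rightarrow> ('a \<Rightarrow> real set) \<Rightarrow> real \<Rightarrow> real \<Rightarrow> real \<Rightarrow> ereal" where
  "expected_gain M S d \<delta> g =
     extended_expectation M (\<lambda>\<omega>. \<Sum>\<tau>. ereal (\<delta> ^ \<tau> * g * real (transactions S d \<tau> \<omega>)))"

text \<open>The vectors \<open>(t\<^sub>1, \<dots>, t\<^sub>k)\<close> with \<open>0 < t\<^sub>1 < \<dots> < t\<^sub>k < T\<close>, and Lebesgue measure in dimension \<open>k\<close>.\<close>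

definition ordered_times :: "nat \<Rightarrow> real \<Rightarrow> (nat \<Rightarrow> real) set" where
  "ordered_times k T =
     {t \<in> {1..k} \<rightarrow>\<^sub>E UNIV. (\<forall>i\<in>{1..k}. 0 < t i \<and> t i < T) \<and>
        (\<forall>i\<in>{1..k}. \<forall>j\<in>{1..k}. i < j \<longrightarrow> t i < t j)}"

abbreviation lborel_upto :: "nat \<Rightarrow> (nat \<Rightarrow> real) measure" where
  "lborel_upto k \<equiv> Pi\<^sub>M {1..k} (\<lambda>_. lborel)"

end

theory Submission
  imports Defs
begin

text \<open>
  Both sides are reduced to one finite sum over the slots. Put \<open>a = \<lambda>\<^sub>1 P\<^sub>b\<^sub>a\<close>, \<open>b = \<lambda>\<^sub>2 P\<^sub>b\<^sub>r\<close>,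
  \<open>K = T\<^sub>w / d\<close>, and let \<open>q\<^sub>i\<close> be the probability that a Poisson variable of mean \<open>a i d\<close> is below
  \<open>r\<^sub>h\<close>.

  The conditional law, summed over the number of arrivals (Poisson thinning), shows that the
  reputation below \<open>r\<^sub>h\<close> at slot \<open>i \<le> K\<close> is distributed as that Poisson variable. Hence slot \<open>i < K\<close>
  has \<open>q\<^sub>i a d + (1 - q\<^sub>i) b d\<close> expected sales and every later slot \<open>(1 - q\<^sub>K) b d\<close>; summation by
  parts turns the discounted series into
  \<open>\<Sum>i<K. \<delta>\<^sup>i (q\<^sub>i (b d \<delta> / (1 - \<delta>) + a d) - q\<^sub>i\<^sub>+\<^sub>1 b d \<delta> / (1 - \<delta>))\<close>.

  On the integral side, splitting off the last time point reduces the integrals over ordered times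
  to one-dimensional ones. The resulting integrand has an antiderivative on each slot, in which the
  first sum of the formula reappears and cancels, and the increments over the slots give the same sum.
\<close>

section \<open>Discounting by slots\<close>

locale slot_discount =
  fixes \<delta> d :: real
  assumes d_pos: "0 < d" and \<delta>_pos: "0 < \<delta>" and \<delta>_le_1: "\<delta> \<le> 1"
begin

definition discount :: "real \<Rightarrow> real" where
  "discount t = \<delta> powi \<lceil>t / d\<rceil>"

definition discount_integral :: "real \<Rightarrow> real" where
  "discount_integral s = integral {0..s} discount"

text \<open>
  Closed form of the integral of \<open>\<Sum>j\<le>k. discount (t\<^sub>j)\<close> over \<open>0 < t\<^sub>1 < \<dots> < t\<^sub>k < s\<close>.
\<close>

primrec total_discount :: "nat \<Rightarrow> real \<Rightarrow> real" where
  "total_discount 0 s = 0"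
| "total_discount (Suc k) s = discount_integral s * s ^ k / fact k"

lemma discount_measurable [measurable]: "discount \<in> borel_measurable borel"
  unfolding discount_def by measurable

lemma discount_nonneg: "0 \<le> discount t"
  unfolding discount_def using \<delta>_pos by simp

lemma discount_le_1: "0 \<le> t \<Longrightarrow> discount t \<le> 1"
proof -
  assume "0 \<le> t"
  then have "0 \<le> \<lceil>t / d\<rceil>" using d_pos
    by (metis ceiling_mono ceiling_zero divide_nonneg_pos)
  then show ?thesis
    unfolding discount_def power_int_def using \<delta>_pos \<delta>_le_1 by (simp add: power_le_one)
qed

text \<open>The exponent in slot \<open>i\<close> is \<open>i + 1\<close>, one more than the
  exponent \<open>i\<close> with which \<open>expected_gain\<close> discounts that slot. This is the
  origin of the factor \<open>1 / \<delta>\<close> in the final formula.\<close>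

lemma discount_in_slot:
  assumes "real i * d < t" "t \<le> real (Suc i) * d"
  shows "discount t = \<delta> ^ Suc i" "\<lceil>t / d\<rceil> = int (Suc i)"
proof -
  show *: "\<lceil>t / d\<rceil> = int (Suc i)"
    using assms d_pos by (intro ceiling_unique) (auto simp: field_simps)
  then show "discount t = \<delta> ^ Suc i" by (simp add: discount_def power_int_def nat_add_distrib)
qed

lemma discount_absolutely_integrable: "0 \<le> x \<Longrightarrow> discount absolutely_integrable_on {x..y}"
proof (rule measurable_bounded_by_integrable_imp_absolutely_integrable[where g = "\<lambda>_. 1"])
  show "discount \<in> borel_measurable (lebesgue_on {x..y})"
    by (intro measurable_restrict_space1 measurable_completion) simp
qed (auto simp: discount_nonneg discount_le_1 intro: integrable_const_ivl)

lemma discount_integrable: "0 \<le> x \<Longrightarrow> discount integrable_on {x..y}"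
  using discount_absolutely_integrable set_lebesgue_integral_eq_integral(1) by blast

lemma discount_integral_nonneg: "0 \<le> discount_integral s"
  unfolding discount_integral_def
  by (cases "0 \<le> s") (auto intro!: integral_nonneg discount_integrable discount_nonneg)

lemma discount_integral_0: "discount_integral 0 = 0"
  unfolding discount_integral_def by simp

lemma continuous_on_discount_integral: "continuous_on {0..T} discount_integral"
  unfolding discount_integral_def
  by (intro indefinite_integral_continuous_1 discount_integrable) simp

text \<open>Inside an open slot \<open>discount\<close> is locally constant, hence continuous, so
  its indefinite integral is differentiable there. Slot boundaries have to be excluded because
  \<open>discount\<close> may jump.\<close>

lemma discount_integral_DERIV:
  assumes "real i * d < s" "s < real (Suc i) * d"
  shows "(discount_integral has_real_derivative discount s) (at s)"
proof -
  define T where "T = real (Suc i) * d"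
  have s0: "0 < s" using assms(1) d_pos by (meson le_less_trans mult_nonneg_nonneg of_nat_0_le_iff less_imp_le)
  have ev: "eventually (\<lambda>t. discount t = \<delta> ^ Suc i) (nhds s)"
    using eventually_nhds_in_open[of "{real i * d<..<real (Suc i) * d}" s] assms
    by (auto elim!: eventually_mono intro: discount_in_slot(1) simp del: of_nat_Suc power_Suc)
  have "isCont discount s"
    using ev by (subst isCont_cong[OF ev]) auto
  \<comment> \<open>The empty set is the exceptional set in the form expected by
    \<open>integral_has_vector_derivative_continuous_at\<close>.\<close>
  then have "continuous (at s within {0..T} - {}) discount"
    using continuous_at_imp_continuous_at_within by blast
  then have "(discount_integral has_vector_derivative discount s) (at s within ({0..T} - {}))"
    unfolding discount_integral_def
    by (intro integral_has_vector_derivative_continuous_at)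
      (use s0 assms in \<open>auto intro: discount_integrable simp: T_def\<close>)
  moreover have "at s within ({0..T} - {}) = at s"
    using s0 assms by (intro at_within_interior) (auto simp: T_def interior_atLeastAtMost_real)
  ultimately show ?thesis by (simp add: has_real_derivative_iff_has_vector_derivative)
qed

lemma total_discount_nonneg: "0 \<le> s \<Longrightarrow> 0 \<le> total_discount k s"
  by (cases k) (auto simp: discount_integral_nonneg)

lemma continuous_on_total_discount: "continuous_on {0..T} (total_discount k)"
  by (cases k) (auto intro!: continuous_intros continuous_on_discount_integral)

lemma total_discount_at_0: "total_discount k 0 = 0"
  by (cases k) (auto simp: discount_integral_0)

text \<open>Product rule: differentiating \<open>discount_integral\<close> gives the term with
  \<open>discount s\<close>, and differentiating the power \<open>s ^ k\<close> gives
  \<open>total_discount k s\<close>.\<close>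

lemma total_discount_DERIV:
  assumes "real i * d < s" "s < real (Suc i) * d"
  shows "(total_discount (Suc k) has_real_derivative (total_discount k s + discount s * s ^ k / fact k)) (at s)"
proof (cases k)
  case 0
  then show ?thesis using discount_integral_DERIV[OF assms] by (subst ext[of "total_discount (Suc k)" discount_integral]) auto
next
  case (Suc j)
  have "((\<lambda>s. discount_integral s * s ^ k / fact k) has_real_derivative
     (discount s * s ^ k + real k * s ^ (k - 1) * discount_integral s) / fact k) (at s)"
    by (auto intro!: derivative_eq_intros discount_integral_DERIV[OF assms])
  moreover have "(real k * s ^ (k - 1) * discount_integral s) / fact k = total_discount k s"
    by (simp add: Suc divide_simps)
  moreover have "total_discount (Suc k) = (\<lambda>s. discount_integral s * s ^ k / fact k)" by auto
  ultimately show ?thesis by (simp only: add_divide_distrib) (simp add: add.commute)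
qed

lemma obtain_slot:
  assumes "0 < s" "s \<notin> (\<lambda>i. real i * d) ` {..n}" "s < real n * d"
  obtains i where "i < n" "real i * d < s" "s < real (Suc i) * d"
proof -
  define i where "i = nat \<lfloor>s / d\<rfloor>"
  have 1: "real i \<le> s / d" "s / d < real (Suc i)" unfolding i_def using assms(1) d_pos
    by (auto simp: of_nat_nat) linarith
  then have 2: "real i * d \<le> s" "s < real (Suc i) * d" using d_pos by (auto simp: field_simps)
  moreover have "real i * d < real n * d" using 2 assms(3) by linarith
  then have "i < n" using d_pos by simp
  moreover have "real i * d \<noteq> s" using assms(2) \<open>i < n\<close> by auto
  ultimately show ?thesis using that by fastforce
qed

text \<open>This is the recursion obtained by fixing the last of \<open>Suc k\<close> ordered times
  at \<open>s\<close>: the earlier times contribute \<open>total_discount k s\<close>, the last one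
  \<open>discount s\<close> times the volume \<open>s ^ k / fact k\<close>. The antiderivative is
  continuous and differentiable off the finitely many slot boundaries, which suffices for the
  fundamental theorem.\<close>

lemma total_discount_has_integral:
  assumes "0 \<le> T"
  shows "((\<lambda>s. total_discount k s + discount s * s ^ k / fact k) has_integral total_discount (Suc k) T) {0..T}"
proof -
  obtain n where n: "T / d < real n" using reals_Archimedean2 by blast
  then have n: "T < real n * d" using d_pos by (simp add: field_simps)
  have "((\<lambda>s. total_discount k s + discount s * s ^ k / fact k) has_integral
      (total_discount (Suc k) T - total_discount (Suc k) 0)) {0..T}"
  proof (rule fundamental_theorem_of_calculus_interior_strong[where S = "(\<lambda>i. real i * d) ` {..n}"])
    fix x assume x: "x \<in> {0<..<T} - (\<lambda>i. real i * d) ` {..n}"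
    then obtain i where "real i * d < x" "x < real (Suc i) * d"
      using obtain_slot[of x n] n by auto
    then show "(total_discount (Suc k) has_vector_derivative total_discount k x + discount x * x ^ k / fact k) (at x)"
      unfolding has_real_derivative_iff_has_vector_derivative[symmetric] by (rule total_discount_DERIV)
  qed (use assms continuous_on_total_discount in \<open>auto simp del: total_discount.simps\<close>)
  then show ?thesis by (simp only: total_discount_at_0 diff_zero)
qed

end

section \<open>Lower Poisson tails and the antiderivative on a slot\<close>

definition poisson_less :: "nat \<Rightarrow> real \<Rightarrow> real" where
  "poisson_less r x = (\<Sum>k<r. x ^ k / fact k * exp (- x))"

text \<open>The derivatives of the summands telescope and only the top term survives. For
  \<open>a > 0\<close> and \<open>s > 0\<close> it is minus the Erlang density of the time of event
  number \<open>Suc m\<close> in a Poisson process of rate \<open>a\<close>.\<close>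

lemma poisson_less_DERIV:
  "((\<lambda>s. poisson_less (Suc m) (a * s)) has_real_derivative - (a * ((a * s) ^ m / fact m * exp (- (a * s))))) (at s)"
proof (induction m)
  case 0
  then show ?case unfolding poisson_less_def by (auto intro!: derivative_eq_intros)
next
  case (Suc m)
  have "((\<lambda>s. (a * s) ^ Suc m * exp (- (a * s))) has_real_derivative
     real (Suc m) * (a * (a * s) ^ m * exp (- (a * s))) - a * ((a * s) ^ Suc m * exp (- (a * s)))) (at s)"
    by (rule derivative_eq_intros refl)+ (simp add: algebra_simps)
  from DERIV_cdivide[OF this, of "fact (Suc m)"]
  have "((\<lambda>s. (a * s) ^ Suc m / fact (Suc m) * exp (- (a * s))) has_real_derivative
     a * ((a * s) ^ m / fact m * exp (- (a * s)))
     - a * ((a * s) ^ Suc m / fact (Suc m) * exp (- (a * s)))) (at s)"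
    by (simp add: diff_divide_distrib mult.assoc del: of_nat_Suc power_Suc)
  from DERIV_add[OF Suc this] show ?case by (simp add: poisson_less_def del: of_nat_Suc fact_Suc power_Suc)
qed

context slot_discount
begin

text \<open>
  The part of the gain (per unit profit) from outcomes with fewer than \<open>r\<close> Poisson events before \<open>s\<close>.
\<close>

definition unramped_discount :: "real \<Rightarrow> nat \<Rightarrow> real \<Rightarrow> real" where
  "unramped_discount a r s = (\<Sum>k<r. exp (- (a * s)) * a ^ k * total_discount k s)"

text \<open>Differentiating the exponential in one summand cancels the \<open>total_discount\<close>
  part of the derivative of the next, so only the last such term remains. The
  \<open>discount s\<close> parts add up to a Poisson tail with one term fewer.\<close>

lemma unramped_discount_DERIV:
  assumes "real i * d < s" "s < real (Suc i) * d"
  shows "(unramped_discount a (Suc m) has_real_derivative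
      a * discount s * poisson_less m (a * s) - a * exp (- (a * s)) * a ^ m * total_discount m s) (at s)"
proof (induction m)
  case 0
  then show ?case by (simp add: unramped_discount_def poisson_less_def)
next
  case (Suc m)
  have "((\<lambda>s. exp (- (a * s)) * a ^ Suc m * total_discount (Suc m) s) has_real_derivative
     - (a * exp (- (a * s)) * a ^ Suc m * total_discount (Suc m) s)
     + exp (- (a * s)) * a ^ Suc m * (total_discount m s + discount s * s ^ m / fact m)) (at s)"
    by (rule derivative_eq_intros total_discount_DERIV[OF assms] refl | simp del: total_discount.simps)+
  from DERIV_add[OF Suc this] show ?case
    unfolding unramped_discount_def
    by (simp add: poisson_less_def algebra_simps power_mult_distrib del: total_discount.simps)
qed

text \<open>The variable \<open>s\<close> is the time of the sale that reaches the threshold. In the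
  bracket, \<open>1\<close> is that sale, \<open>a * (d * of_int \<lceil>s / d\<rceil> - s)\<close>
  the mean number of sales in the rest of the slot at the still unchanged rate, and \<open>C\<close>
  the later sales, discounted relative to this slot.\<close>

lemma ramp_up_has_integral_slot:
  fixes a C :: real and m i :: nat
  defines "g \<equiv> \<lambda>s. a * exp (- (a * s)) * a ^ m * (total_discount m s + s ^ m / fact m *
      (discount s * (1 + C + a * (d * of_int \<lceil>s / d\<rceil> - s))))"
  shows "(g has_integral
      unramped_discount a (Suc m) (real i * d) - unramped_discount a (Suc m) (real (Suc i) * d)
      + \<delta> ^ Suc i * (poisson_less (Suc m) (a * (real i * d)) * (C + a * d)
         - poisson_less (Suc m) (a * (real (Suc i) * d)) * C)) {real i * d..real (Suc i) * d}"
proof -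
  \<comment> \<open>On a slot the integrand has an elementary antiderivative: the first sum of the theorem enters with
    a minus sign and will cancel there, and \<open>a\<close> times the Poisson weight is minus the derivative of
    \<^const>\<open>poisson_less\<close>.\<close>
  define H where "H = (\<lambda>s. - unramped_discount a (Suc m) s
     - \<delta> ^ Suc i * (poisson_less (Suc m) (a * s) * (C + a * (d * real (Suc i) - s))))"
  have "(g has_integral H (real (Suc i) * d) - H (real i * d)) {real i * d..real (Suc i) * d}"
  proof (rule fundamental_theorem_of_calculus_interior)
    show "real i * d \<le> real (Suc i) * d" using d_pos by simp
    show "continuous_on {real i * d..real (Suc i) * d} H"
      unfolding H_def unramped_discount_def poisson_less_def using d_pos
      by (intro continuous_intros continuous_on_subset[OF continuous_on_total_discount[of "real (Suc i) * d"]]) auto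
    fix s assume "s \<in> {real i * d<..<real (Suc i) * d}"
    then have s: "real i * d < s" "s < real (Suc i) * d" by auto
    have g: "g s = a * exp (- (a * s)) * a ^ m * (total_discount m s + s ^ m / fact m *
      (\<delta> ^ Suc i * (1 + C + a * (d * real (Suc i) - s))))"
      unfolding g_def using discount_in_slot[OF s(1) less_imp_le[OF s(2)]] by simp
    \<comment> \<open>The \<open>1\<close> in the integrand comes from the difference of
      \<open>poisson_less (Suc m)\<close> and \<open>poisson_less m\<close>: the former arises from
      differentiating the factor linear in \<open>s\<close>, the latter from
      \<open>unramped_discount\<close>.\<close>
    have "(H has_real_derivative g s) (at s)"
      unfolding H_def
      apply (rule derivative_eq_intros unramped_discount_DERIV[OF s] poisson_less_DERIV refl)+
      apply (simp only: g discount_in_slot(1)[OF s(1) less_imp_le[OF s(2)]])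
      apply (simp add: poisson_less_def algebra_simps power_mult_distrib add_divide_distrib diff_divide_distrib del: of_nat_Suc power_Suc)
      done
    then show "(H has_vector_derivative g s) (at s)"
      by (simp add: has_real_derivative_iff_has_vector_derivative)
  qed
  moreover have "H (real (Suc i) * d) - H (real i * d) =
      unramped_discount a (Suc m) (real i * d) - unramped_discount a (Suc m) (real (Suc i) * d)
      + \<delta> ^ Suc i * (poisson_less (Suc m) (a * (real i * d)) * (C + a * d)
         - poisson_less (Suc m) (a * (real (Suc i) * d)) * C)"
    unfolding H_def by (simp add: algebra_simps)
  ultimately show ?thesis by simp
qed

text \<open>Over consecutive slots the \<open>unramped_discount\<close> increments telescope, and
  the value at \<open>0\<close> vanishes.\<close>

lemma ramp_up_has_integral:
  fixes a C :: real and m K :: nat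
  shows "((\<lambda>s. a * exp (- (a * s)) * a ^ m * (total_discount m s + s ^ m / fact m *
      (discount s * (1 + C + a * (d * of_int \<lceil>s / d\<rceil> - s))))) has_integral
      (\<Sum>i<K. \<delta> ^ Suc i * (poisson_less (Suc m) (a * (real i * d)) * (C + a * d)
         - poisson_less (Suc m) (a * (real (Suc i) * d)) * C))
      - unramped_discount a (Suc m) (real K * d)) {0..real K * d}"
proof (induction K)
  case 0
  then show ?case by (simp add: unramped_discount_def total_discount_at_0 has_integral_refl(2))
next
  case (Suc K)
  show ?case
    using has_integral_combine[OF _ _ Suc ramp_up_has_integral_slot[of a m C K]] d_pos
    by (simp add: algebra_simps)
qed

end

section \<open>Integrals over ordered times\<close>

declare One_nat_def [simp del] \<comment> \<open>keeps the index sets \<open>{1..k}\<close> in \<^const>\<open>ordered_times\<close> from becoming \<open>{Suc 0..k}\<close>\<close>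

lemma sets_ordered_times [measurable]: "ordered_times k T \<in> sets (lborel_upto k)"
proof -
  have "ordered_times k T = {t \<in> space (lborel_upto k). (\<forall>i\<in>{1..k}. 0 < t i \<and> t i < T) \<and>
        (\<forall>i\<in>{1..k}. \<forall>j\<in>{1..k}. i < j \<longrightarrow> t i < t j)}"
    by (auto simp: ordered_times_def space_PiM)
  also have "\<dots> \<in> sets (lborel_upto k)"
    by (intro sets.sets_Collect_conj sets.sets_Collect_finite_All sets.sets_Collect_imp sets.sets_Collect_const
          borel_measurable_less) (auto intro!: measurable_component_singleton)
  finally show ?thesis .
qed

lemmas indicator_ordered_times_measurable [measurable] =
  borel_measurable_indicator[OF sets_ordered_times]

text \<open>The last point of an increasing tuple bounds all the others, so once it is fixed as
  \<open>y\<close> the remaining constraint is the same one with \<open>y\<close> in place of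
  \<open>T\<close>. This makes inductions on the dimension possible.\<close>

lemma ordered_times_Suc:
  assumes "t \<in> space (lborel_upto k)"
  shows "t(Suc k := y) \<in> ordered_times (Suc k) T \<longleftrightarrow> y \<in> {0<..<T} \<and> t \<in> ordered_times k y"
proof -
  have iff: "i \<in> {1..Suc k} \<longleftrightarrow> i = Suc k \<or> i \<in> {1..k}" for i by auto
  have ne: "i \<in> {1..k} \<Longrightarrow> i \<noteq> Suc k" "i \<in> {1..k} \<Longrightarrow> i < Suc k" "i \<in> {1..k} \<Longrightarrow> \<not> Suc k < i" for i by auto
  have "t \<in> {1..k} \<rightarrow>\<^sub>E UNIV" using assms by (simp add: space_PiM)
  moreover have "t(Suc k := y) \<in> {1..Suc k} \<rightarrow>\<^sub>E UNIV"
    using assms by (auto simp: space_PiM PiE_def extensional_def)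
  ultimately show ?thesis
    unfolding ordered_times_def mem_Collect_eq Ball_def iff
    using ne by (auto simp: fun_upd_def)
qed

interpretation lborel_product: product_sigma_finite "\<lambda>_::nat. lborel :: real measure"
  by standard

text \<open>Tonelli with the last time as the outermost variable; the indicator factors by
  \<open>ordered_times_Suc\<close>. Non-negative integrals avoid integrability conditions at this
  stage.\<close>

lemma nn_integral_lborel_upto_Suc:
  assumes [measurable]: "f \<in> borel_measurable (lborel_upto (Suc k))"
  shows "(\<integral>\<^sup>+ t. f t * indicator (ordered_times (Suc k) T) t \<partial>lborel_upto (Suc k)) =
     (\<integral>\<^sup>+ y. (\<integral>\<^sup>+ t. f (t(Suc k := y)) * indicator (ordered_times k y) t \<partial>lborel_upto k) * indicator {0<..<T} y \<partial>lborel)"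
proof -
  have ins: "{1..Suc k} = insert (Suc k) {1..k}" by auto
  have upd: "(\<lambda>t. t(Suc k := y)) \<in> lborel_upto k \<rightarrow>\<^sub>M lborel_upto (Suc k)" for y
    unfolding ins by (rule measurable_fun_upd[where J = "{1..k}"]) auto
  have *: "(\<integral>\<^sup>+ t. f (t(Suc k := y)) * indicator (ordered_times (Suc k) T) (t(Suc k := y)) \<partial>lborel_upto k)
    = (\<integral>\<^sup>+ t. f (t(Suc k := y)) * indicator (ordered_times k y) t \<partial>lborel_upto k) * indicator {0<..<T} y" for y
  proof -
    have "(\<integral>\<^sup>+ t. f (t(Suc k := y)) * indicator (ordered_times (Suc k) T) (t(Suc k := y)) \<partial>lborel_upto k)
      = (\<integral>\<^sup>+ t. (f (t(Suc k := y)) * indicator (ordered_times k y) t) * indicator {0<..<T} y \<partial>lborel_upto k)"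
      using ordered_times_Suc[of _ k y T]
      by (intro nn_integral_cong) (auto split: split_indicator)
    also have "\<dots> = (\<integral>\<^sup>+ t. f (t(Suc k := y)) * indicator (ordered_times k y) t \<partial>lborel_upto k) * indicator {0<..<T} y"
      by (intro nn_integral_multc borel_measurable_times_ennreal measurable_compose[OF upd assms]
          indicator_ordered_times_measurable)
    finally show ?thesis .
  qed
  have m: "(\<lambda>t. f t * indicator (ordered_times (Suc k) T) t) \<in> borel_measurable (lborel_upto (Suc k))"
    by measurable
  show ?thesis
    using lborel_product.product_nn_integral_insert_rev[of "{1..k}" "Suc k", folded ins, OF _ _ m]
    unfolding * by simp
qed

text \<open>Transfers a gauge integral obtained from an antiderivative to Lebesgue measure; the two
  endpoints form a null set.\<close>

lemma nn_integral_indicator_has_integral: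
  fixes f :: "real \<Rightarrow> real"
  assumes I: "(f has_integral I) {0..T}" and nn: "\<And>x. 0 \<le> x \<Longrightarrow> x \<le> T \<Longrightarrow> 0 \<le> f x"
  shows "(\<integral>\<^sup>+ y. ennreal (f y) * indicator {0<..<T} y \<partial>lborel) = ennreal I"
proof -
  have "(\<integral>\<^sup>+ y. ennreal (f y) * indicator {0<..<T} y \<partial>lborel) = (\<integral>\<^sup>+ y. indicator {0<..<T} y * f y \<partial>lborel)"
    by (intro nn_integral_cong) (auto split: split_indicator)
  also have "\<dots> = I"
    using nn I has_integral_open_interval[of f I 0 T]
    by (intro nn_integral_has_integral_lebesgue) auto
  finally show ?thesis .
qed

lemma volume_ordered_times:
  "0 \<le> T \<Longrightarrow> (\<integral>\<^sup>+ t. indicator (ordered_times k T) t \<partial>lborel_upto k) = ennreal (T ^ k / fact k)"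
proof (induction k arbitrary: T)
  case 0
  \<comment> \<open>Without coordinates the constraints are void and the set is the whole one-point
    space, of volume \<open>1\<close>.\<close>
  have "ordered_times 0 T = space (lborel_upto 0)" by (auto simp: ordered_times_def space_PiM)
  then show ?case using lborel_product.nn_integral_empty[of "indicator (ordered_times 0 T)"]
    by (simp add: space_PiM del: nn_integral_indicator)
next
  case (Suc k)
  have "(\<integral>\<^sup>+ t. indicator (ordered_times (Suc k) T) t \<partial>lborel_upto (Suc k)) =
    (\<integral>\<^sup>+ y. (\<integral>\<^sup>+ t. indicator (ordered_times k y) t \<partial>lborel_upto k) * indicator {0<..<T} y \<partial>lborel)"
    using nn_integral_lborel_upto_Suc[of "\<lambda>_. 1" k T] by simp
  also have "\<dots> = (\<integral>\<^sup>+ y. ennreal (y ^ k / fact k) * indicator {0<..<T} y \<partial>lborel)"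
    using Suc.IH by (intro nn_integral_cong) (auto split: split_indicator simp del: nn_integral_indicator)
  also have "\<dots> = ennreal (T ^ Suc k / fact (Suc k))"
  proof (rule nn_integral_indicator_has_integral)
    have "((\<lambda>y. y ^ k / fact k) has_integral T ^ Suc k / fact (Suc k) - 0 ^ Suc k / fact (Suc k)) {0..T}"
    proof (rule fundamental_theorem_of_calculus[OF Suc.prems])
      fix x assume "x \<in> {0..T}"
      have "((\<lambda>y. y ^ Suc k / fact (Suc k)) has_real_derivative real (Suc k) * x ^ k / fact (Suc k)) (at x within {0..T})"
        by (rule derivative_eq_intros refl)+ (simp_all add: divide_simps)
      then show "((\<lambda>y. y ^ Suc k / fact (Suc k)) has_vector_derivative x ^ k / fact k) (at x within {0..T})"
        by (simp add: has_real_derivative_iff_has_vector_derivative del: power_Suc of_nat_Suc)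
    qed
    then show "((\<lambda>y. y ^ k / fact k) has_integral T ^ Suc k / fact (Suc k)) {0..T}" by simp
  qed auto
  finally show ?case .
qed

context slot_discount
begin

lemma component_discount_measurable [measurable]:
  "j \<in> {1..k} \<Longrightarrow> (\<lambda>t. discount (t j)) \<in> borel_measurable (lborel_upto k)"
  by (rule measurable_compose[OF measurable_component_singleton]) auto

text \<open>Fixing the last time \<open>y\<close> splits the sum into the earlier discounts, covered
  by the induction hypothesis, and the constant \<open>discount y\<close> times a volume. The outer
  integral is then the recursion \<open>total_discount_has_integral\<close>.\<close>

lemma nn_integral_total_discount:
  "0 \<le> T \<Longrightarrow> (\<integral>\<^sup>+ t. ennreal (\<Sum>j = 1..k. discount (t j)) * indicator (ordered_times k T) t \<partial>lborel_upto k)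
     = ennreal (total_discount k T)"
proof (induction k arbitrary: T)
  case 0
  then show ?case by simp
next
  case (Suc k)
  have [measurable]: "(\<lambda>t. ennreal (\<Sum>j = 1..Suc k. discount (t j))) \<in> borel_measurable (lborel_upto (Suc k))"
    by (intro measurable_compose[OF _ measurable_ennreal] borel_measurable_sum component_discount_measurable)
  have [measurable]: "(\<lambda>t. ennreal (\<Sum>j = 1..k. discount (t j))) \<in> borel_measurable (lborel_upto k)"
    by (intro measurable_compose[OF _ measurable_ennreal] borel_measurable_sum component_discount_measurable)
  have inner: "(\<integral>\<^sup>+ t. ennreal (\<Sum>j = 1..Suc k. discount ((t(Suc k := y)) j)) * indicator (ordered_times k y) t \<partial>lborel_upto k)
    = ennreal (total_discount k y + discount y * y ^ k / fact k)" if "0 \<le> y" for y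
  proof -
    have "(\<integral>\<^sup>+ t. ennreal (\<Sum>j = 1..Suc k. discount ((t(Suc k := y)) j)) * indicator (ordered_times k y) t \<partial>lborel_upto k)
     = (\<integral>\<^sup>+ t. ennreal (\<Sum>j = 1..k. discount (t j)) * indicator (ordered_times k y) t +
           ennreal (discount y) * indicator (ordered_times k y) t \<partial>lborel_upto k)"
      by (intro nn_integral_cong)
        (auto split: split_indicator simp: discount_nonneg sum_nonneg intro!: ennreal_plus[symmetric])
    also have "\<dots> = ennreal (total_discount k y) + ennreal (discount y) * ennreal (y ^ k / fact k)"
      using Suc.IH[OF that] volume_ordered_times[OF that, of k]
      by (simp add: nn_integral_add nn_integral_cmult indicator_ordered_times_measurable
          borel_measurable_times_ennreal del: nn_integral_indicator)
    also have "\<dots> = ennreal (total_discount k y + discount y * y ^ k / fact k)"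
      using that total_discount_nonneg[OF that] discount_nonneg[of y]
      by (simp flip: ennreal_plus ennreal_mult)
    finally show ?thesis .
  qed
  have "(\<integral>\<^sup>+ t. ennreal (\<Sum>j = 1..Suc k. discount (t j)) * indicator (ordered_times (Suc k) T) t \<partial>lborel_upto (Suc k))
    = (\<integral>\<^sup>+ y. ennreal (total_discount k y + discount y * y ^ k / fact k) * indicator {0<..<T} y \<partial>lborel)"
    by (subst nn_integral_lborel_upto_Suc) (auto intro!: nn_integral_cong simp: inner split: split_indicator simp del: sum.cl_ivl_Suc fun_upd_apply)
  also have "\<dots> = ennreal (total_discount (Suc k) T)"
    by (rule nn_integral_indicator_has_integral[OF total_discount_has_integral[OF Suc.prems]])
      (simp add: total_discount_nonneg discount_nonneg)
  finally show ?case .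
qed

text \<open>The integrand is non-negative, so its finite non-negative integral yields integrability
  and the value together. Factors of unknown sign, such as \<open>u\<close>, are pulled out before
  this is applied.\<close>

lemma integral_ordered_times:
  assumes "0 \<le> T" "0 \<le> c"
  shows "has_bochner_integral (lborel_upto k)
    (\<lambda>t. indicator (ordered_times k T) t *\<^sub>R ((\<Sum>j = 1..k. discount (t j)) + c))
    (total_discount k T + c * T ^ k / fact k)"
proof (rule has_bochner_integral_nn_integral)
  show "(\<lambda>t. indicator (ordered_times k T) t *\<^sub>R ((\<Sum>j = 1..k. discount (t j)) + c)) \<in> borel_measurable (lborel_upto k)"
    by (intro borel_measurable_scaleR borel_measurable_add borel_measurable_sum component_discount_measurable
        indicator_ordered_times_measurable) auto
  have [measurable]: "(\<lambda>t. ennreal (\<Sum>j = 1..k. discount (t j))) \<in> borel_measurable (lborel_upto k)"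
    by (intro measurable_compose[OF _ measurable_ennreal] borel_measurable_sum component_discount_measurable)
  have "(\<integral>\<^sup>+ t. ennreal (indicator (ordered_times k T) t *\<^sub>R ((\<Sum>j = 1..k. discount (t j)) + c)) \<partial>lborel_upto k)
    = (\<integral>\<^sup>+ t. ennreal (\<Sum>j = 1..k. discount (t j)) * indicator (ordered_times k T) t +
           ennreal c * indicator (ordered_times k T) t \<partial>lborel_upto k)"
    using assms by (intro nn_integral_cong)
      (auto split: split_indicator simp: discount_nonneg sum_nonneg intro!: ennreal_plus)
  also have "\<dots> = ennreal (total_discount k T) + ennreal c * ennreal (T ^ k / fact k)"
    using nn_integral_total_discount[OF assms(1), of k] volume_ordered_times[OF assms(1), of k]
    by (simp add: nn_integral_add nn_integral_cmult indicator_ordered_times_measurable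
          borel_measurable_times_ennreal del: nn_integral_indicator)
  also have "\<dots> = ennreal (total_discount k T + c * T ^ k / fact k)"
    using assms total_discount_nonneg[OF assms(1)] by (simp flip: ennreal_plus ennreal_mult)
  finally show "(\<integral>\<^sup>+ t. ennreal (indicator (ordered_times k T) t *\<^sub>R ((\<Sum>j = 1..k. discount (t j)) + c)) \<partial>lborel_upto k)
    = ennreal (total_discount k T + c * T ^ k / fact k)" .
qed (use assms in \<open>auto simp: discount_nonneg sum_nonneg total_discount_nonneg\<close>)


section \<open>Evaluation of the two terms of the gain formula\<close>

lemma mult_ceiling_ge: "s \<le> d * of_int \<lceil>s / d\<rceil>"
  using le_of_int_ceiling[of "s / d"] unfolding pos_divide_le_eq[OF d_pos] by (simp add: mult.commute)

text \<open>The factor \<open>fact k / T ^ k\<close> normalises Lebesgue measure on the ordered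
  times to a probability. Against the Poisson weight it leaves just
  \<open>a ^ k * exp (- (a * T))\<close>, the coefficient in
  \<open>unramped_discount\<close>.\<close>

lemma integral_unramped:
  assumes "0 < T"
  shows "(\<Sum>k = 0..m. (a * T) ^ k / fact k * exp (- (a * T)) *
      (LINT t:ordered_times k T|lborel_upto k. fact k / T ^ k * (\<Sum>j = 1..k. u * discount (t j))))
    = u * unramped_discount a (Suc m) T"
proof -
  have "(a * T) ^ k / fact k * exp (- (a * T)) *
      (LINT t:ordered_times k T|lborel_upto k. fact k / T ^ k * (\<Sum>j = 1..k. u * discount (t j)))
      = u * (exp (- (a * T)) * a ^ k * total_discount k T)" for k
  proof -
    have "(LINT t:ordered_times k T|lborel_upto k. fact k / T ^ k * (\<Sum>j = 1..k. u * discount (t j)))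
      = (LINT t|lborel_upto k. (fact k / T ^ k * u) * (indicator (ordered_times k T) t *\<^sub>R ((\<Sum>j = 1..k. discount (t j)) + 0)))"
      unfolding set_lebesgue_integral_def
      by (intro Bochner_Integration.integral_cong refl) (simp add: sum_distrib_left[symmetric] mult_ac)
    also have "\<dots> = fact k / T ^ k * u * total_discount k T"
      using integral_ordered_times[of T 0 k] assms
      unfolding integral_mult_right_zero has_bochner_integral_iff by simp
    finally show ?thesis using assms by (simp add: field_simps power_mult_distrib)
  qed
  then show ?thesis
    by (simp add: unramped_discount_def sum_distrib_left lessThan_Suc_atMost atLeast0AtMost)
qed

lemma integral_ramped_inner:
  assumes "0 \<le> s" "0 \<le> a" "0 \<le> b" "\<delta> < 1"
  shows "(LINT t:ordered_times m s|lborel_upto m.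
            a * exp (- (a * s)) * ((a * s) ^ m / fact m) * (fact m / s ^ m) * u
            * ((\<Sum>j = 1..Suc m. discount ((t(Suc m := s)) j))
               + b * d * (\<delta> powi (\<lceil>s / d\<rceil> + 1) / (1 - \<delta>))
               + discount s * a * (d * of_int \<lceil>s / d\<rceil> - s)))
     = u * (a * exp (- (a * s)) * a ^ m * (total_discount m s + s ^ m / fact m *
      (discount s * (1 + b * d * \<delta> / (1 - \<delta>) + a * (d * of_int \<lceil>s / d\<rceil> - s)))))"
    (is "?L = u * (a * exp (- (a * s)) * a ^ m * (_ + _ / _ * ?c))")
proof (cases "s = 0 \<and> 0 < m")
  \<comment> \<open>Here \<open>s ^ m = 0\<close>, so the integrand and the right-hand side both
    vanish. For \<open>m = 0\<close> the point \<open>s = 0\<close> is regular, since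
    \<open>0 ^ 0 = 1\<close>.\<close>
  case True
  then show ?thesis by (simp add: total_discount_at_0 set_lebesgue_integral_def)
next
  case False
  have c: "0 \<le> ?c"
    using assms d_pos \<delta>_pos mult_ceiling_ge[of s] discount_nonneg[of s] by simp
  have powi: "\<delta> powi (\<lceil>s / d\<rceil> + 1) = discount s * \<delta>"
    unfolding discount_def using \<delta>_pos by (simp add: power_int_add)
  have *: "a * exp (- (a * s)) * ((a * s) ^ m / fact m) * (fact m / s ^ m) * u
            * ((\<Sum>j = 1..Suc m. discount ((t(Suc m := s)) j))
               + b * d * (\<delta> powi (\<lceil>s / d\<rceil> + 1) / (1 - \<delta>))
               + discount s * a * (d * of_int \<lceil>s / d\<rceil> - s))
     = (u * a * exp (- (a * s)) * a ^ m) * ((\<Sum>j = 1..m. discount (t j)) + ?c)" for t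
  proof -
    \<comment> \<open>Only the last summand sees the update \<open>t(Suc m := s)\<close>; it
      contributes the \<open>1\<close> in \<open>?c\<close>, and everything else in
      \<open>?c\<close> is constant in \<open>t\<close>.\<close>
    have "(\<Sum>j = 1..Suc m. discount ((t(Suc m := s)) j)) = (\<Sum>j = 1..m. discount (t j)) + discount s"
      by (simp add: One_nat_def)
    with powi have "(\<Sum>j = 1..Suc m. discount ((t(Suc m := s)) j))
               + b * d * (\<delta> powi (\<lceil>s / d\<rceil> + 1) / (1 - \<delta>))
               + discount s * a * (d * of_int \<lceil>s / d\<rceil> - s) = (\<Sum>j = 1..m. discount (t j)) + ?c"
      by (simp only:) (simp add: algebra_simps)
    moreover have "a * exp (- (a * s)) * ((a * s) ^ m / fact m) * (fact m / s ^ m) * u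
       = u * a * exp (- (a * s)) * a ^ m"
      using False by (cases "m = 0") (simp_all add: power_mult_distrib)
    ultimately show ?thesis by (simp only:)
  qed
  have "?L = (LINT t|lborel_upto m. (u * a * exp (- (a * s)) * a ^ m) * (indicator (ordered_times m s) t *\<^sub>R ((\<Sum>j = 1..m. discount (t j)) + ?c)))"
    unfolding set_lebesgue_integral_def *
    by (intro Bochner_Integration.integral_cong) (simp_all add: mult_ac)
  also have "\<dots> = u * a * exp (- (a * s)) * a ^ m * (total_discount m s + ?c * s ^ m / fact m)"
    using integral_ordered_times[OF assms(1) c, of m]
    by (simp only: integral_mult_right_zero has_bochner_integral_iff)
  finally show ?thesis by (simp add: mult_ac)
qed

lemma integral_ramped_outer:
  assumes "0 \<le> a" "0 \<le> C" "T = real K * d"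
  shows "(LINT s:{0..T}|lborel. a * exp (- (a * s)) * a ^ m * (total_discount m s + s ^ m / fact m *
      (discount s * (1 + C + a * (d * of_int \<lceil>s / d\<rceil> - s))))) =
      (\<Sum>i<K. \<delta> ^ Suc i * (poisson_less (Suc m) (a * (real i * d)) * (C + a * d)
         - poisson_less (Suc m) (a * (real (Suc i) * d)) * C))
      - unramped_discount a (Suc m) T" (is "(LINT s:_|_. ?g s) = ?I")
proof -
  have g: "0 \<le> ?g s" if "0 \<le> s" for s
    using that assms mult_ceiling_ge[of s] discount_nonneg[of s] total_discount_nonneg[of s m]
    by (intro mult_nonneg_nonneg add_nonneg_nonneg divide_nonneg_nonneg) auto
  \<comment> \<open>Measurability of \<open>total_discount\<close> is derived from continuity on
    \<open>{0..T}\<close>, so the indicator has to stay attached to it.\<close>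
  have [measurable]: "(\<lambda>s. indicator {0..T} s *\<^sub>R total_discount m s) \<in> borel_measurable borel"
    by (intro borel_measurable_continuous_on_indicator continuous_on_total_discount) simp
  have "(\<lambda>s. a * exp (- (a * s)) * a ^ m * (indicator {0..T} s *\<^sub>R total_discount m s + indicator {0..T} s * (s ^ m / fact m *
      (discount s * (1 + C + a * (d * of_int \<lceil>s / d\<rceil> - s)))))) \<in> borel_measurable borel"
    by measurable
  also have "(\<lambda>s. a * exp (- (a * s)) * a ^ m * (indicator {0..T} s *\<^sub>R total_discount m s + indicator {0..T} s * (s ^ m / fact m *
      (discount s * (1 + C + a * (d * of_int \<lceil>s / d\<rceil> - s)))))) = (\<lambda>s. indicator {0..T} s *\<^sub>R ?g s)"
    by (auto split: split_indicator)
  finally have m: "(\<lambda>s. indicator {0..T} s *\<^sub>R ?g s) \<in> borel_measurable borel" .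
  have I: "(?g has_integral ?I) {0..T}"
    using ramp_up_has_integral[of a m C K] assms by simp
  have "has_bochner_integral lborel (\<lambda>s. indicator {0..T} s *\<^sub>R ?g s) ?I"
  proof (rule has_bochner_integral_nn_integral)
    have "(\<integral>\<^sup>+ s. ennreal (indicator {0..T} s *\<^sub>R ?g s) \<partial>lborel) = (\<integral>\<^sup>+ s. indicator {0..T} s * ?g s \<partial>lborel)"
      by (intro nn_integral_cong) (auto split: split_indicator)
    also have "\<dots> = ?I"
      using nn_integral_has_integral_lebesgue[OF _ I] g by simp
    finally show "(\<integral>\<^sup>+ s. ennreal (indicator {0..T} s *\<^sub>R ?g s) \<partial>lborel) = ennreal ?I" .
    show "0 \<le> ?I" using I g by (rule has_integral_nonneg) simp
  qed (use m g in \<open>auto split: split_indicator\<close>)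
  then show ?thesis unfolding set_lebesgue_integral_def by (simp add: has_bochner_integral_iff)
qed

text \<open>The first term equals \<open>u * unramped_discount a (Suc m) T\<close>, and the ramped
  integral contains the same quantity with a minus sign, so only the sum over slots remains.\<close>

lemma gain_integrals_eq_slot_sum:
  assumes "0 < T" "0 \<le> a" "0 \<le> b" "\<delta> < 1" "T = real K * d"
  shows "(\<Sum>k = 0..m. (a * T) ^ k / fact k * exp (- (a * T)) *
      (LINT t:ordered_times k T|lborel_upto k. fact k / T ^ k * (\<Sum>j = 1..k. u * discount (t j))))
    + (LINT s:{0..T}|lborel. LINT t:ordered_times m s|lborel_upto m.
            a * exp (- (a * s)) * ((a * s) ^ m / fact m) * (fact m / s ^ m) * u
            * ((\<Sum>j = 1..Suc m. discount ((t(Suc m := s)) j))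
               + b * d * (\<delta> powi (\<lceil>s / d\<rceil> + 1) / (1 - \<delta>))
               + discount s * a * (d * of_int \<lceil>s / d\<rceil> - s)))
    = u * (\<Sum>i<K. \<delta> ^ Suc i * (poisson_less (Suc m) (a * (real i * d)) * (b * d * \<delta> / (1 - \<delta>) + a * d)
         - poisson_less (Suc m) (a * (real (Suc i) * d)) * (b * d * \<delta> / (1 - \<delta>))))"
    (is "_ + (LINT s:_|_. ?f s) = u * ?S")
proof -
  let ?g = "\<lambda>s. a * exp (- (a * s)) * a ^ m * (total_discount m s + s ^ m / fact m *
      (discount s * (1 + b * d * \<delta> / (1 - \<delta>) + a * (d * of_int \<lceil>s / d\<rceil> - s))))"
  have "(LINT s:{0..T}|lborel. ?f s) = (LINT s:{0..T}|lborel. u * ?g s)"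
    by (rule set_lebesgue_integral_cong) (use integral_ramped_inner[OF _ assms(2-4)] in auto)
  also have "\<dots> = u * (?S - unramped_discount a (Suc m) T)"
    using integral_ramped_outer[OF assms(2) _ assms(5), of "b * d * \<delta> / (1 - \<delta>)" m] assms d_pos \<delta>_pos
    by simp
  finally show ?thesis unfolding integral_unramped[OF assms(1)] by (simp add: algebra_simps)
qed

end

section \<open>The law of the reputation and expected sales\<close>

text \<open>Terms with \<open>n < k\<close> vanish because the binomial weight does. After the shift
  \<open>n = i + k\<close> the rest is the exponential series of \<open>\<mu> * (1 - p)\<close>,
  which turns \<open>exp (- \<mu>)\<close> into \<open>exp (- (\<mu> * p))\<close>.\<close>

lemma poisson_thinning_sums:
  fixes \<mu> p :: real
  assumes "0 < \<mu>" "0 \<le> p" "p \<le> 1"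
  shows "(\<lambda>n. pmf (poisson_pmf \<mu>) n * pmf (binomial_pmf n p) k) sums ((\<mu> * p) ^ k / fact k * exp (- (\<mu> * p)))"
proof -
  let ?f = "\<lambda>n. pmf (poisson_pmf \<mu>) n * pmf (binomial_pmf n p) k"
  have shift: "?f (i + k) = (\<mu> * p) ^ k / fact k * exp (- \<mu>) * ((\<mu> * (1 - p)) ^ i /\<^sub>R fact i)" for i
    using assms by (simp add: binomial_fact power_add power_mult_distrib divide_simps)
  have "(\<lambda>i. ?f (i + k)) sums ((\<mu> * p) ^ k / fact k * exp (- \<mu>) * exp (\<mu> * (1 - p)))"
    unfolding shift by (intro sums_mult exp_converges)
  also have "(\<mu> * p) ^ k / fact k * exp (- \<mu>) * exp (\<mu> * (1 - p)) = (\<mu> * p) ^ k / fact k * exp (- (\<mu> * p))"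
    by (simp add: exp_add[symmetric] algebra_simps)
  finally show ?thesis
    using assms by (subst (asm) sums_zero_iff_shift) auto
qed

lemma poisson_mean_sums:
  fixes \<mu> :: real
  shows "(\<lambda>k. real k * (\<mu> ^ k / fact k * exp (- \<mu>))) sums \<mu>"
proof -
  let ?f = "\<lambda>k. real k * (\<mu> ^ k / fact k * exp (- \<mu>))"
  have shift: "?f (i + Suc 0) = \<mu> * exp (- \<mu>) * (\<mu> ^ i /\<^sub>R fact i)" for i
    by (simp add: divide_simps)
  have "(\<lambda>i. ?f (i + Suc 0)) sums (\<mu> * exp (- \<mu>) * exp \<mu>)"
    unfolding shift by (intro sums_mult exp_converges)
  then have "?f sums (\<mu> * exp (- \<mu>) * exp \<mu>)"
    by (subst (asm) sums_zero_iff_shift) auto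
  moreover have "\<mu> * exp (- \<mu>) * exp \<mu> = \<mu>" by (simp add: exp_minus)
  ultimately show ?thesis by simp
qed

lemma poisson_convolution:
  fixes x y :: real
  shows "(\<Sum>j\<le>k. (x ^ j / fact j * exp (- x)) * (y ^ (k - j) / fact (k - j) * exp (- y)))
    = (x + y) ^ k / fact k * exp (- (x + y))"
proof -
  have "(x + y) ^ k / fact k = (\<Sum>j\<le>k. x ^ j / fact j * (y ^ (k - j) / fact (k - j)))"
    unfolding binomial_ring sum_divide_distrib
    by (intro sum.cong refl) (simp add: binomial_fact)
  then have "(x + y) ^ k / fact k * exp (- (x + y)) =
      (\<Sum>j\<le>k. x ^ j / fact j * (y ^ (k - j) / fact (k - j)) * (exp (- x) * exp (- y)))"
    by (simp add: sum_distrib_right exp_add[symmetric])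
  then show ?thesis by (simp add: mult_ac)
qed

lemma points_in_split:
  assumes "finite (X \<omega> \<inter> {0..<t})" "0 \<le> s" "s \<le> t"
  shows "points_in X 0 t \<omega> = points_in X 0 s \<omega> + points_in X s t \<omega>"
proof -
  have "X \<omega> \<inter> {0..<t} = (X \<omega> \<inter> {0..<s}) \<union> (X \<omega> \<inter> {s..<t})" using assms by auto
  then show ?thesis
    unfolding points_in_def using assms(1)
    by (subst card_Un_disjoint[symmetric]) auto
qed

section \<open>Reputation and drop-out in terms of cumulative sales\<close>

locale ramping_seller = honest_seller +
  fixes K :: nat
  assumes d_pos: "0 < d" and r_h_pos: "0 < r_h" and \<theta>_le_1: "\<theta> \<le> 1"
    and lam1_pos: "0 < lam1" and lam2_pos: "0 < lam2"
    and P_ba: "0 \<le> P_ba" "P_ba \<le> 1" and P_br: "0 \<le> P_br" "P_br \<le> 1"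
    and T_w_eq: "T_w = real K * d"
begin

text \<open>A single \<open>points_in\<close> count from time \<open>0\<close>, so its level sets
  are generators of \<open>history\<close>; on \<open>space M\<close> it agrees with the recursive
  \<open>reputation\<close>.\<close>

definition sold :: "nat \<Rightarrow> 'a \<Rightarrow> nat" where
  "sold \<tau> = points_in S 0 (real \<tau> * d)"

lemma transactions_finite: "\<omega> \<in> space M \<Longrightarrow> finite (S \<omega> \<inter> {0..<t})"
  by (rule finite_subset[OF _ arrivals_locally_finite[of \<omega> t]]) (use transactions_subset_arrivals in auto)

lemma sold_Suc:
  assumes "\<omega> \<in> space M"
  shows "sold (Suc \<tau>) \<omega> = sold \<tau> \<omega> + transactions S d \<tau> \<omega>"
  unfolding transactions_def sold_def
  by (rule points_in_split) (use transactions_finite[OF assms] d_pos in \<open>auto intro: mult_right_mono\<close>)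

lemma sold_0 [simp]: "sold 0 \<omega> = 0"
  by (simp add: points_in_def sold_def)

lemma reputation_eq: "\<omega> \<in> space M \<Longrightarrow> reputation S d \<tau> \<omega> = int (sold \<tau> \<omega>)"
  by (induction \<tau>) (auto simp: sold_Suc)

lemma feedbacks_eq: "\<omega> \<in> space M \<Longrightarrow> feedbacks S d \<tau> \<omega> = sold \<tau> \<omega>"
  unfolding feedbacks_def by (induction \<tau>) (auto simp: sold_Suc)

lemma sold_mono: "\<omega> \<in> space M \<Longrightarrow> i \<le> j \<Longrightarrow> sold i \<omega> \<le> sold j \<omega>"
  by (rule lift_Suc_mono_le[of "\<lambda>i. sold i \<omega>"]) (auto simp: sold_Suc)

text \<open>Cumulative sales are monotone, so the least slot reaching the threshold exceeds
  \<open>K\<close> exactly if the threshold is not yet reached at \<open>K\<close>. If it is never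
  reached the ramp up time is infinite and the same test applies.\<close>

lemma dropped_out_iff:
  assumes "\<omega> \<in> space M"
  shows "dropped_out S d r_h T_w \<tau> \<omega> \<longleftrightarrow> sold K \<omega> < r_h \<and> K \<le> \<tau>"
proof -
  have "ereal T_w < ramp_up_time S d r_h \<omega> \<longleftrightarrow> sold K \<omega> < r_h"
  proof (cases "\<exists>\<tau>. r_h \<le> sold \<tau> \<omega>")
    case True
    define L where "L = (LEAST \<tau>. r_h \<le> sold \<tau> \<omega>)"
    have L: "r_h \<le> sold L \<omega>" unfolding L_def using True by (rule LeastI_ex)
    have "ramp_up_time S d r_h \<omega> = ereal (d * real L)"
      using True assms by (simp add: ramp_up_time_def reputation_eq L_def)
    then have "ereal T_w < ramp_up_time S d r_h \<omega> \<longleftrightarrow> K < L"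
      using d_pos by (simp add: T_w_eq mult.commute)
    also have "\<dots> \<longleftrightarrow> sold K \<omega> < r_h"
      using sold_mono[OF assms, of L K] L not_less_Least[of K "\<lambda>\<tau>. r_h \<le> sold \<tau> \<omega>"]
      by (fastforce simp: L_def[symmetric] not_less)
    finally show ?thesis .
  next
    case False
    then have "ramp_up_time S d r_h \<omega> = \<infinity>" using assms by (simp add: ramp_up_time_def reputation_eq)
    then show ?thesis using False by (simp add: not_le)
  qed
  moreover have "T_w / d \<le> real \<tau> \<longleftrightarrow> K \<le> \<tau>" using d_pos by (simp add: T_w_eq)
  ultimately show ?thesis by (simp add: dropped_out_def)
qed

lemma arrival_rate_eq:
  "\<omega> \<in> space M \<Longrightarrow> arrival_rate S d r_h lam1 lam2 \<tau> \<omega> = (if sold \<tau> \<omega> < r_h then lam1 else lam2)"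
  by (simp add: arrival_rate_def reputation_eq)

text \<open>At or above the threshold there is at least one feedback because \<open>r_h > 0\<close>,
  so the positive fraction is \<open>1\<close> and not the default value of
  \<open>0 / 0\<close>.\<close>

lemma purchase_prob_eq:
  assumes "\<omega> \<in> space M"
  shows "purchase_prob S d r_h \<theta> T_w P_ba P_br \<tau> \<omega> =
    (if sold K \<omega> < r_h \<and> K \<le> \<tau> then 0 else if r_h \<le> sold \<tau> \<omega> then P_br else P_ba)"
  using \<theta>_le_1 r_h_pos assms
  by (auto simp: purchase_prob_def dropped_out_iff labeled_reputable_def reputation_eq feedbacks_eq)

lemma space_history [simp]: "space (history M B S s) = space M"
  unfolding history_def by (rule space_measure_of) auto

lemma sets_history_subset: "sets (history M B S s) \<subseteq> sets M"
proof -
  note [measurable] = arrivals_measurable transactions_measurable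
  have 1: "{\<omega> \<in> space M. points_in B 0 w \<omega> = n} \<in> sets M" for w n by measurable
  have 2: "{\<omega> \<in> space M. points_in S 0 w \<omega> = n} \<in> sets M" for w n by measurable
  have "sets (history M B S s) = sigma_sets (space M)
     ({{\<omega> \<in> space M. points_in B 0 w \<omega> = n} | w n. w \<le> s} \<union>
      {{\<omega> \<in> space M. points_in S 0 w \<omega> = n} | w n. w \<le> s})"
    unfolding history_def by (rule sets_measure_of) auto
  also have "\<dots> \<subseteq> sets M"
    by (rule sets.sigma_sets_subset) (auto simp: 1 2)
  finally show ?thesis .
qed

lemma sold_history_measurable:
  assumes "i \<le> \<tau>"
  shows "sold i \<in> history M B S (real \<tau> * d) \<rightarrow>\<^sub>M count_space UNIV"
proof (subst measurable_count_space_eq2_countable)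
  have "{\<omega> \<in> space M. sold i \<omega> = n} \<in> sets (history M B S (real \<tau> * d))" for n
  proof -
    have "real i * d \<le> real \<tau> * d" using assms d_pos by (simp add: mult_right_mono)
    then show ?thesis unfolding history_def sold_def by (intro in_measure_of) auto
  qed
  then show "sold i \<in> space (history M B S (real \<tau> * d)) \<rightarrow> UNIV \<and>
     (\<forall>n\<in>UNIV. sold i -` {n} \<inter> space (history M B S (real \<tau> * d)) \<in> sets (history M B S (real \<tau> * d)))"
    by (auto simp: vimage_def Int_def conj_commute)
qed

lemma sold_event_history:
  "i \<le> \<tau> \<Longrightarrow> {\<omega> \<in> space M. Q (sold i \<omega>)} \<in> sets (history M B S (real \<tau> * d))"
  using measurable_sets_Collect[OF sold_history_measurable, of i \<tau> Q] by simp

lemma sold_measurable [measurable]: "sold i \<in> M \<rightarrow>\<^sub>M count_space UNIV"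
  unfolding sold_def by (rule transactions_measurable)

text \<open>Measurability is assumed only for counts from time \<open>0\<close>; a slot count is the
  difference of two of these.\<close>

lemma slot_points_measurable:
  assumes [measurable]: "\<And>t. points_in X 0 t \<in> M \<rightarrow>\<^sub>M count_space UNIV"
    and fin: "\<And>\<omega> t. \<omega> \<in> space M \<Longrightarrow> finite (X \<omega> \<inter> {0..<t})"
  shows "transactions X d \<tau> \<in> M \<rightarrow>\<^sub>M count_space UNIV"
proof -
  have "transactions X d \<tau> \<omega> =
    points_in X 0 (real (Suc \<tau>) * d) \<omega> - points_in X 0 (real \<tau> * d) \<omega>" if "\<omega> \<in> space M" for \<omega>
    using points_in_split[where X = X and t = "real (Suc \<tau>) * d", OF fin[OF that], of "real \<tau> * d"] d_pos
    by (simp add: mult_right_mono transactions_def)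
  moreover have "(\<lambda>\<omega>. points_in X 0 (real (Suc \<tau>) * d) \<omega> - points_in X 0 (real \<tau> * d) \<omega>) \<in> M \<rightarrow>\<^sub>M count_space UNIV"
    by measurable
  ultimately show ?thesis by (subst measurable_cong) auto
qed

lemma slot_transactions_measurable [measurable]: "transactions S d \<tau> \<in> M \<rightarrow>\<^sub>M count_space UNIV"
  by (intro slot_points_measurable transactions_measurable transactions_finite)

lemma slot_arrivals_measurable [measurable]: "transactions B d \<tau> \<in> M \<rightarrow>\<^sub>M count_space UNIV"
  by (intro slot_points_measurable arrivals_measurable arrivals_locally_finite)

section \<open>Sales within one slot given the past\<close>

lemma prob_slot_transactions:
  assumes A: "A \<in> sets (history M B S (real \<tau> * d))"
    and rate: "\<And>\<omega>. \<omega> \<in> A \<Longrightarrow> arrival_rate S d r_h lam1 lam2 \<tau> \<omega> = l" "0 < l"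
    and buy: "\<And>\<omega>. \<omega> \<in> A \<Longrightarrow> purchase_prob S d r_h \<theta> T_w P_ba P_br \<tau> \<omega> = q" "0 \<le> q" "q \<le> 1"
  shows "prob (A \<inter> {\<omega> \<in> space M. transactions S d \<tau> \<omega> = k}) =
    prob A * ((l * q * d) ^ k / fact k * exp (- (l * q * d)))"
proof -
  let ?B = "transactions B d \<tau>" and ?S = "transactions S d \<tau>"
  let ?E = "\<lambda>n. A \<inter> {\<omega> \<in> space M. ?B \<omega> = n \<and> ?S \<omega> = k}"
  have [measurable]: "A \<in> sets M" using A sets_history_subset by blast
  \<comment> \<open>Rate and purchase probability are constant on \<open>A\<close>, so the integrand
    of \<open>conditional_law\<close> is constant there and factors out. Summing over the number
    \<open>n\<close> of arrivals is then Poisson thinning.\<close>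
  have "prob (?E n) = prob A * (pmf (poisson_pmf (l * d)) n * pmf (binomial_pmf n q) k)" for n
  proof -
    have "real (Suc \<tau>) * d - real \<tau> * d = d" by (simp add: algebra_simps)
    then have "prob (?E n) = (LINT \<omega>:A|M.
            pmf (poisson_pmf (arrival_rate S d r_h lam1 lam2 \<tau> \<omega> * d)) n *
            pmf (binomial_pmf n (purchase_prob S d r_h \<theta> T_w P_ba P_br \<tau> \<omega>)) k)"
      unfolding transactions_def using conditional_law[OF _ _ _ A, of \<tau> "real (Suc \<tau>) * d" n k] d_pos by simp
    also have "\<dots> = (LINT \<omega>:A|M. pmf (poisson_pmf (l * d)) n * pmf (binomial_pmf n q) k)"
      by (rule set_lebesgue_integral_cong) (auto simp: rate buy)
    also have "\<dots> = prob A * (pmf (poisson_pmf (l * d)) n * pmf (binomial_pmf n q) k)"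
      unfolding set_lebesgue_integral_def by simp
    finally show ?thesis .
  qed
  moreover have "(\<lambda>n. prob (?E n)) sums prob (\<Union>n. ?E n)"
    by (rule finite_measure_UNION) (auto simp: disjoint_family_on_def)
  ultimately have "(\<lambda>n. prob A * (pmf (poisson_pmf (l * d)) n * pmf (binomial_pmf n q) k)) sums prob (\<Union>n. ?E n)"
    by simp
  moreover have "(\<Union>n. ?E n) = A \<inter> {\<omega> \<in> space M. ?S \<omega> = k}" by auto
  ultimately show ?thesis
    using sums_unique2[OF _ sums_mult[OF poisson_thinning_sums[of "l * d" q k], of "prob A"]] rate(2) buy(2,3) d_pos
    by (simp add: mult_ac)
qed

text \<open>Writing the count as the sum of \<open>k\<close> times the indicator that it equals
  \<open>k\<close> reduces the expectation to the Poisson mean.\<close>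

lemma nn_integral_slot_transactions:
  assumes A: "A \<in> sets (history M B S (real \<tau> * d))"
    and rate: "\<And>\<omega>. \<omega> \<in> A \<Longrightarrow> arrival_rate S d r_h lam1 lam2 \<tau> \<omega> = l" "0 < l"
    and buy: "\<And>\<omega>. \<omega> \<in> A \<Longrightarrow> purchase_prob S d r_h \<theta> T_w P_ba P_br \<tau> \<omega> = q" "0 \<le> q" "q \<le> 1"
  shows "(\<integral>\<^sup>+\<omega>. ennreal (real (transactions S d \<tau> \<omega>)) * indicator A \<omega> \<partial>M) = ennreal (prob A * (l * q * d))"
proof -
  let ?E = "\<lambda>k. A \<inter> {\<omega> \<in> space M. transactions S d \<tau> \<omega> = k}"
  have [measurable]: "A \<in> sets M" using A sets_history_subset by blast
  have "(\<integral>\<^sup>+\<omega>. ennreal (real (transactions S d \<tau> \<omega>)) * indicator A \<omega> \<partial>M) =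
    (\<integral>\<^sup>+\<omega>. (\<Sum>k. ennreal (real k) * indicator (?E k) \<omega>) \<partial>M)"
  proof (rule nn_integral_cong)
    fix \<omega> assume "\<omega> \<in> space M"
    have "(\<Sum>k. ennreal (real k) * indicator (?E k) \<omega>) = (\<Sum>k\<in>{transactions S d \<tau> \<omega>}. ennreal (real k) * indicator (?E k) \<omega>)"
      by (rule suminf_finite) (simp_all add: indicator_def)
    also have "\<dots> = ennreal (real (transactions S d \<tau> \<omega>)) * indicator A \<omega>"
      using \<open>\<omega> \<in> space M\<close> by (simp add: indicator_def)
    finally show "ennreal (real (transactions S d \<tau> \<omega>)) * indicator A \<omega> = (\<Sum>k. ennreal (real k) * indicator (?E k) \<omega>)" ..
  qed
  also have "\<dots> = (\<Sum>k. \<integral>\<^sup>+\<omega>. ennreal (real k) * indicator (?E k) \<omega> \<partial>M)"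
    by (intro nn_integral_suminf) measurable
  also have "\<dots> = (\<Sum>k. ennreal (prob A * (real k * ((l * q * d) ^ k / fact k * exp (- (l * q * d))))))"
  proof (rule suminf_cong)
    fix k
    have "(\<integral>\<^sup>+\<omega>. ennreal (real k) * indicator (?E k) \<omega> \<partial>M) = ennreal (real k) * ennreal (prob (?E k))"
      by (simp add: nn_integral_cmult_indicator emeasure_eq_measure)
    also have "\<dots> = ennreal (prob A * (real k * ((l * q * d) ^ k / fact k * exp (- (l * q * d)))))"
      using prob_slot_transactions[OF A rate buy, of k]
      by (simp only: ennreal_mult'[symmetric, OF of_nat_0_le_iff] mult.left_commute)
    finally show "(\<integral>\<^sup>+\<omega>. ennreal (real k) * indicator (?E k) \<omega> \<partial>M) =
      ennreal (prob A * (real k * ((l * q * d) ^ k / fact k * exp (- (l * q * d)))))" .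
  qed
  also have "\<dots> = ennreal (prob A * (l * q * d))"
  proof (rule suminf_ennreal_eq)
    show "(\<lambda>k. prob A * (real k * ((l * q * d) ^ k / fact k * exp (- (l * q * d))))) sums (prob A * (l * q * d))"
      by (rule sums_mult[OF poisson_mean_sums])
  qed (use rate(2) buy(2) d_pos in auto)
  finally show ?thesis .
qed

text \<open>A total \<open>k < r_h\<close> forces every earlier total \<open>j\<close> below the
  threshold as well, and slots before \<open>K\<close> precede any drop-out. Each slot therefore
  adds a Poisson number of mean \<open>lam1 * P_ba * d\<close> with the same law for every such
  past, and convolution adds the means.\<close>

lemma prob_sold:
  "\<tau> \<le> K \<Longrightarrow> k < r_h \<Longrightarrow>
    prob {\<omega> \<in> space M. sold \<tau> \<omega> = k} =
    (lam1 * P_ba * (real \<tau> * d)) ^ k / fact k * exp (- (lam1 * P_ba * (real \<tau> * d)))"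
proof (induction \<tau> arbitrary: k)
  case 0
  then show ?case by (cases k) (auto simp: prob_space simp del: mult_eq_0_iff)
next
  case (Suc \<tau>)
  let ?E = "\<lambda>j. {\<omega> \<in> space M. sold \<tau> \<omega> = j} \<inter> {\<omega> \<in> space M. transactions S d \<tau> \<omega> = k - j}"
  let ?x = "lam1 * P_ba * (real \<tau> * d)" and ?y = "lam1 * P_ba * d"
  have "{\<omega> \<in> space M. sold (Suc \<tau>) \<omega> = k} = (\<Union>j\<le>k. ?E j)"
    by (auto simp: sold_Suc)
  then have "prob {\<omega> \<in> space M. sold (Suc \<tau>) \<omega> = k} = prob (\<Union>j\<le>k. ?E j)" by simp
  also have "\<dots> = (\<Sum>j\<le>k. prob (?E j))"
    by (rule finite_measure_finite_Union) (auto simp: disjoint_family_on_def)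
  also have "\<dots> = (\<Sum>j\<le>k. (?x ^ j / fact j * exp (- ?x)) * (?y ^ (k - j) / fact (k - j) * exp (- ?y)))"
  proof (rule sum.cong[OF refl])
    fix j assume "j \<in> {..k}"
    then have j: "j < r_h" using Suc.prems by auto
    have "prob (?E j) = prob {\<omega> \<in> space M. sold \<tau> \<omega> = j} * (?y ^ (k - j) / fact (k - j) * exp (- ?y))"
      by (rule prob_slot_transactions[OF sold_event_history])
        (use j Suc.prems lam1_pos P_ba in \<open>auto simp: arrival_rate_eq purchase_prob_eq\<close>)
    then show "prob (?E j) = (?x ^ j / fact j * exp (- ?x)) * (?y ^ (k - j) / fact (k - j) * exp (- ?y))"
      using Suc.IH[OF _ j] Suc.prems by simp
  qed
  also have "\<dots> = (?x + ?y) ^ k / fact k * exp (- (?x + ?y))" by (rule poisson_convolution)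
  also have "?x + ?y = lam1 * P_ba * (real (Suc \<tau>) * d)" by (simp add: algebra_simps)
  finally show ?case .
qed

lemma prob_average:
  assumes "\<tau> \<le> K"
  shows "prob {\<omega> \<in> space M. sold \<tau> \<omega> < r_h} = poisson_less r_h (lam1 * P_ba * (real \<tau> * d))"
proof -
  have "{\<omega> \<in> space M. sold \<tau> \<omega> < r_h} = (\<Union>k<r_h. {\<omega> \<in> space M. sold \<tau> \<omega> = k})" by auto
  then have "prob {\<omega> \<in> space M. sold \<tau> \<omega> < r_h} = (\<Sum>k<r_h. prob {\<omega> \<in> space M. sold \<tau> \<omega> = k})"
    by (simp only:) (rule finite_measure_finite_Union, auto simp: disjoint_family_on_def)
  then show ?thesis using prob_sold[OF assms] by (simp add: poisson_less_def)
qed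

lemma prob_reputable:
  assumes "\<tau> \<le> K"
  shows "prob {\<omega> \<in> space M. \<not> sold \<tau> \<omega> < r_h} = 1 - poisson_less r_h (lam1 * P_ba * (real \<tau> * d))"
  using prob_neg[of "\<lambda>\<omega>. sold \<tau> \<omega> < r_h"] prob_average[OF assms] by simp

text \<open>From slot \<open>K\<close> on a seller who has not ramped up is gone and one who has
  stays reputable, so the value no longer depends on \<open>\<tau>\<close>.\<close>

definition mean_sales :: "nat \<Rightarrow> real" where
  "mean_sales \<tau> = (if \<tau> < K
     then poisson_less r_h (lam1 * P_ba * (real \<tau> * d)) * (lam1 * P_ba * d)
       + (1 - poisson_less r_h (lam1 * P_ba * (real \<tau> * d))) * (lam2 * P_br * d)
     else (1 - poisson_less r_h (lam1 * P_ba * (real K * d))) * (lam2 * P_br * d))"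

lemma expected_transactions:
  "(\<integral>\<^sup>+\<omega>. ennreal (real (transactions S d \<tau> \<omega>)) \<partial>M) = ennreal (mean_sales \<tau>)"
proof -
  let ?f = "\<lambda>\<omega>. ennreal (real (transactions S d \<tau> \<omega>))"
  have split: "(\<integral>\<^sup>+\<omega>. f \<omega> \<partial>M) = (\<integral>\<^sup>+\<omega>. f \<omega> * indicator {\<omega> \<in> space M. sold i \<omega> < r_h} \<omega> \<partial>M)
     + (\<integral>\<^sup>+\<omega>. f \<omega> * indicator {\<omega> \<in> space M. \<not> sold i \<omega> < r_h} \<omega> \<partial>M)"
    if [measurable]: "f \<in> borel_measurable M" for i f
    by (subst nn_integral_add[symmetric]) (auto intro!: nn_integral_cong split: split_indicator)
  have br: "0 \<le> lam1 * P_ba * d" "0 \<le> lam2 * P_br * d"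
    using lam1_pos lam2_pos P_ba P_br d_pos by auto
  show ?thesis
  proof (cases "\<tau> < K")
    case True
    have "(\<integral>\<^sup>+\<omega>. ?f \<omega> * indicator {\<omega> \<in> space M. sold \<tau> \<omega> < r_h} \<omega> \<partial>M)
      = ennreal (prob {\<omega> \<in> space M. sold \<tau> \<omega> < r_h} * (lam1 * P_ba * d))"
      by (rule nn_integral_slot_transactions[OF sold_event_history])
        (use True lam1_pos P_ba in \<open>auto simp: arrival_rate_eq purchase_prob_eq\<close>)
    moreover have "(\<integral>\<^sup>+\<omega>. ?f \<omega> * indicator {\<omega> \<in> space M. \<not> sold \<tau> \<omega> < r_h} \<omega> \<partial>M)
      = ennreal (prob {\<omega> \<in> space M. \<not> sold \<tau> \<omega> < r_h} * (lam2 * P_br * d))"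
      by (rule nn_integral_slot_transactions[OF sold_event_history[where Q = "\<lambda>n. \<not> n < r_h"]])
        (use True lam2_pos P_br in \<open>auto simp: arrival_rate_eq purchase_prob_eq\<close>)
    ultimately have "(\<integral>\<^sup>+\<omega>. ?f \<omega> \<partial>M) = ennreal (prob {\<omega> \<in> space M. sold \<tau> \<omega> < r_h} * (lam1 * P_ba * d)
        + prob {\<omega> \<in> space M. \<not> sold \<tau> \<omega> < r_h} * (lam2 * P_br * d))"
      using br split[of ?f \<tau>] by (subst ennreal_plus) auto
    then show ?thesis using True by (simp only: prob_average prob_reputable less_imp_le mean_sales_def if_True)
  next
    case False
    \<comment> \<open>After drop-out the purchase probability is \<open>0\<close>, but the arrival
      rate still depends on \<open>sold \<tau>\<close>. The event \<open>?D\<close> is split once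
      more so that the rate is constant on each piece.\<close>
    let ?D = "{\<omega> \<in> space M. sold K \<omega> < r_h}" and ?Av = "{\<omega> \<in> space M. sold \<tau> \<omega> < r_h}"
    have "(\<integral>\<^sup>+\<omega>. ?f \<omega> * indicator ?D \<omega> \<partial>M)
      = (\<integral>\<^sup>+\<omega>. ?f \<omega> * indicator (?D \<inter> ?Av) \<omega> \<partial>M)
        + (\<integral>\<^sup>+\<omega>. ?f \<omega> * indicator (?D \<inter> {\<omega> \<in> space M. \<not> sold \<tau> \<omega> < r_h}) \<omega> \<partial>M)"
      by (subst split[of _ \<tau>]) (simp_all add: mult.assoc indicator_inter_arith[symmetric])
    also have "(\<integral>\<^sup>+\<omega>. ?f \<omega> * indicator (?D \<inter> ?Av) \<omega> \<partial>M) = ennreal (prob (?D \<inter> ?Av) * (lam1 * 0 * d))"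
      by (rule nn_integral_slot_transactions[OF sets.Int[OF sold_event_history sold_event_history]])
        (use False lam1_pos in \<open>auto simp: arrival_rate_eq purchase_prob_eq\<close>)
    also have "(\<integral>\<^sup>+\<omega>. ?f \<omega> * indicator (?D \<inter> {\<omega> \<in> space M. \<not> sold \<tau> \<omega> < r_h}) \<omega> \<partial>M)
      = ennreal (prob (?D \<inter> {\<omega> \<in> space M. \<not> sold \<tau> \<omega> < r_h}) * (lam2 * 0 * d))"
      by (rule nn_integral_slot_transactions[OF sets.Int[OF sold_event_history sold_event_history[where Q = "\<lambda>n. \<not> n < r_h"]]])
        (use False lam2_pos in \<open>auto simp: arrival_rate_eq purchase_prob_eq\<close>)
    finally have D: "(\<integral>\<^sup>+\<omega>. ?f \<omega> * indicator ?D \<omega> \<partial>M) = 0" by simp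
    have "(\<integral>\<^sup>+\<omega>. ?f \<omega> * indicator {\<omega> \<in> space M. \<not> sold K \<omega> < r_h} \<omega> \<partial>M)
      = ennreal (prob {\<omega> \<in> space M. \<not> sold K \<omega> < r_h} * (lam2 * P_br * d))"
    proof (rule nn_integral_slot_transactions[OF sold_event_history[where Q = "\<lambda>n. \<not> n < r_h"]])
      fix \<omega> assume "\<omega> \<in> {\<omega> \<in> space M. \<not> sold K \<omega> < r_h}"
      then have w: "\<omega> \<in> space M" "r_h \<le> sold K \<omega>" "r_h \<le> sold \<tau> \<omega>"
        using sold_mono[of \<omega> K \<tau>] False by auto
      then show "arrival_rate S d r_h lam1 lam2 \<tau> \<omega> = lam2"
        "purchase_prob S d r_h \<theta> T_w P_ba P_br \<tau> \<omega> = P_br"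
        by (auto simp: arrival_rate_eq purchase_prob_eq)
    qed (use False lam2_pos P_br in auto)
    with D split[of ?f K] show ?thesis
      using False by (simp only: prob_reputable[OF order_refl] mean_sales_def if_False) auto
  qed
qed

lemma poisson_less_le_1: "\<tau> \<le> K \<Longrightarrow> poisson_less r_h (lam1 * P_ba * (real \<tau> * d)) \<le> 1"
  using prob_average[of \<tau>] by (metis prob_le_1)

lemma mean_sales_nonneg: "0 \<le> mean_sales \<tau>"
proof -
  have "0 \<le> poisson_less r_h (lam1 * P_ba * (real \<tau> * d))"
    unfolding poisson_less_def using lam1_pos P_ba d_pos
    by (intro sum_nonneg mult_nonneg_nonneg divide_nonneg_nonneg zero_le_power) auto
  then show ?thesis
    using poisson_less_le_1[of \<tau>] poisson_less_le_1[of K] lam1_pos lam2_pos P_ba P_br d_pos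
    by (auto simp: mean_sales_def)
qed

end

section \<open>Expected gains\<close>

text \<open>Summation by parts as an induction on \<open>K\<close>: the first term is the geometric
  tail of all slots from \<open>K\<close> on, and each step moves one slot out of it. At
  \<open>K = 0\<close> the tail vanishes because \<open>q 0 = 1\<close>.\<close>

lemma discounted_slot_sum:
  fixes q :: "nat \<Rightarrow> real" and \<delta> x y :: real
  assumes "q 0 = 1" "\<delta> < 1"
  shows "\<delta> ^ K * ((1 - q K) * y) / (1 - \<delta>) + (\<Sum>i<K. \<delta> ^ i * (q i * x + (1 - q i) * y))
    = (\<Sum>i<K. \<delta> ^ i * (q i * (y * \<delta> / (1 - \<delta>) + x) - q (Suc i) * (y * \<delta> / (1 - \<delta>))))"
proof (induction K)
  case 0
  then show ?case using assms by simp
next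
  case (Suc K)
  have "\<delta> ^ Suc K * ((1 - q (Suc K)) * y) / (1 - \<delta>) + \<delta> ^ K * (q K * x + (1 - q K) * y)
    = \<delta> ^ K * ((1 - q K) * y) / (1 - \<delta>)
      + \<delta> ^ K * (q K * (y * \<delta> / (1 - \<delta>) + x) - q (Suc K) * (y * \<delta> / (1 - \<delta>)))"
    using assms(2) by (simp add: divide_simps) (simp add: algebra_simps)
  with Suc show ?case by simp
qed

section \<open>Signed gains as multiples of a non-negative expectation\<close>

lemma suminf_ereal_cmult_ennreal:
  assumes "\<And>i. 0 \<le> f i"
  shows "(\<Sum>i. ereal (g * f i)) = ereal g * enn2ereal (\<Sum>i. ennreal (f i))"
proof (rule sums_unique[symmetric])
  have "(\<lambda>i. ennreal (f i)) sums (\<Sum>i. ennreal (f i))" by (simp add: summable_sums)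
  then have "(\<lambda>i. enn2ereal (ennreal (f i))) sums enn2ereal (\<Sum>i. ennreal (f i))"
    by (simp only: sums_enn2ereal)
  then have "(\<lambda>n. ereal (\<Sum>i<n. f i)) \<longlonglongrightarrow> enn2ereal (\<Sum>i. ennreal (f i))"
    using assms by (simp add: sums_def enn2ereal_ennreal)
  then have "(\<lambda>n. ereal g * ereal (\<Sum>i<n. f i)) \<longlonglongrightarrow> ereal g * enn2ereal (\<Sum>i. ennreal (f i))"
    by (intro tendsto_cmult_ereal) auto
  then show "(\<lambda>i. ereal (g * f i)) sums (ereal g * enn2ereal (\<Sum>i. ennreal (f i)))"
    by (simp add: sums_def sum_distrib_left)
qed

lemma e2ennreal_cmult_enn2ereal:
  "0 \<le> g \<Longrightarrow> e2ennreal (ereal g * enn2ereal x) = ennreal g * x"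
  by (metis e2ennreal_enn2ereal enn2ereal_ennreal times_ennreal.rep_eq)

text \<open>The sign of \<open>g\<close> makes either the negative or the positive part vanish, so
  no difference of two infinities can occur even if the integral of \<open>Y\<close> is
  infinite.\<close>

lemma extended_expectation_cmult:
  assumes [measurable]: "Y \<in> borel_measurable M"
  shows "extended_expectation M (\<lambda>\<omega>. ereal g * enn2ereal (Y \<omega>)) = ereal g * enn2ereal (\<integral>\<^sup>+\<omega>. Y \<omega> \<partial>M)"
proof (cases "0 \<le> g")
  case True
  have "e2ennreal (- (ereal g * enn2ereal x)) = 0" for x
    using True by (intro e2ennreal_neg) simp
  then show ?thesis
    using True unfolding extended_expectation_def
    by (simp add: e2ennreal_cmult_enn2ereal nn_integral_cmult times_ennreal.rep_eq enn2ereal_ennreal zero_ennreal.rep_eq)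
next
  case False
  have neg: "- (ereal g * x) = ereal (- g) * x" for x by (cases x) auto
  have 1: "e2ennreal (ereal g * enn2ereal x) = 0" for x
    using False by (intro e2ennreal_neg) (simp add: ereal_mult_le_0_iff)
  have 2: "e2ennreal (- (ereal g * enn2ereal x)) = ennreal (- g) * x" for x
    using False e2ennreal_cmult_enn2ereal[of "- g" x] unfolding neg by simp
  have "extended_expectation M (\<lambda>\<omega>. ereal g * enn2ereal (Y \<omega>)) = - (ereal (- g) * enn2ereal (\<integral>\<^sup>+\<omega>. Y \<omega> \<partial>M))"
    using False unfolding extended_expectation_def 1 2
    by (simp add: nn_integral_cmult times_ennreal.rep_eq enn2ereal_ennreal zero_ennreal.rep_eq)
  then show ?thesis unfolding neg[symmetric] by simp
qed

context ramping_seller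
begin

text \<open>Isolates \<open>g\<close> from an extended real that does not depend on it.
  Proportionality of two gains thus holds for all positive \<open>\<delta>\<close>, also where they
  are infinite.\<close>

lemma expected_gain_eq:
  assumes "0 < \<delta>"
  shows "expected_gain M S d \<delta> g =
    ereal g * enn2ereal (\<integral>\<^sup>+\<omega>. (\<Sum>\<tau>. ennreal (\<delta> ^ \<tau> * real (transactions S d \<tau> \<omega>))) \<partial>M)"
proof -
  have "(\<Sum>\<tau>. ereal (\<delta> ^ \<tau> * g * real (transactions S d \<tau> \<omega>))) =
    ereal g * enn2ereal (\<Sum>\<tau>. ennreal (\<delta> ^ \<tau> * real (transactions S d \<tau> \<omega>)))" for \<omega>
  proof -
    have "(\<Sum>\<tau>. ereal (\<delta> ^ \<tau> * g * real (transactions S d \<tau> \<omega>))) =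
      (\<Sum>\<tau>. ereal (g * (\<delta> ^ \<tau> * real (transactions S d \<tau> \<omega>))))"
      by (simp only: mult.assoc mult.left_commute)
    also have "\<dots> = ereal g * enn2ereal (\<Sum>\<tau>. ennreal (\<delta> ^ \<tau> * real (transactions S d \<tau> \<omega>)))"
      by (rule suminf_ereal_cmult_ennreal) (use assms in simp)
    finally show ?thesis .
  qed
  then show ?thesis
    unfolding expected_gain_def by (simp only:) (rule extended_expectation_cmult, measurable)
qed

lemma mean_sales_sums:
  fixes \<delta> :: real
  defines "q \<equiv> \<lambda>\<tau>. poisson_less r_h (lam1 * P_ba * (real \<tau> * d))"
  assumes "0 < \<delta>" "\<delta> < 1"
  shows "(\<lambda>\<tau>. \<delta> ^ \<tau> * mean_sales \<tau>) sums
    (\<Sum>i<K. \<delta> ^ i * (q i * (lam2 * P_br * d * \<delta> / (1 - \<delta>) + lam1 * P_ba * d)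
        - q (Suc i) * (lam2 * P_br * d * \<delta> / (1 - \<delta>))))"
proof -
  let ?x = "lam1 * P_ba * d" and ?y = "lam2 * P_br * d"
  obtain m where "r_h = Suc m" using r_h_pos by (cases r_h) auto
  \<comment> \<open>At mean \<open>0\<close> only the term \<open>k = 0\<close> is non-zero, and it
    is present since \<open>r_h > 0\<close>.\<close>
  then have q0: "q 0 = 1" by (simp add: q_def poisson_less_def sum.lessThan_Suc_shift del: sum.lessThan_Suc)
  have "(\<lambda>i. \<delta> ^ (i + K) * mean_sales (i + K)) = (\<lambda>i. \<delta> ^ K * ((1 - q K) * ?y) * \<delta> ^ i)"
    by (simp add: mean_sales_def q_def power_add mult_ac fun_eq_iff)
  moreover have "(\<lambda>i. \<delta> ^ K * ((1 - q K) * ?y) * \<delta> ^ i) sums (\<delta> ^ K * ((1 - q K) * ?y) * (1 / (1 - \<delta>)))"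
    using assms by (intro sums_mult geometric_sums) simp
  ultimately have "(\<lambda>i. \<delta> ^ (i + K) * mean_sales (i + K)) sums (\<delta> ^ K * ((1 - q K) * ?y) / (1 - \<delta>))"
    by simp
  then have "(\<lambda>\<tau>. \<delta> ^ \<tau> * mean_sales \<tau>) sums
     (\<delta> ^ K * ((1 - q K) * ?y) / (1 - \<delta>) + (\<Sum>i<K. \<delta> ^ i * mean_sales i))"
    by (rule sums_iff_shift[THEN iffD1])
  also have "(\<Sum>i<K. \<delta> ^ i * mean_sales i) = (\<Sum>i<K. \<delta> ^ i * (q i * ?x + (1 - q i) * ?y))"
    by (intro sum.cong) (auto simp: mean_sales_def q_def)
  finally show ?thesis unfolding discounted_slot_sum[where q = q, OF q0 assms(3)] .
qed

lemma expected_gain_slot_sum: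
  assumes "0 < \<delta>" "\<delta> < 1"
  shows "expected_gain M S d \<delta> g = ereal (g *
    (\<Sum>i<K. \<delta> ^ i * (poisson_less r_h (lam1 * P_ba * (real i * d)) * (lam2 * P_br * d * \<delta> / (1 - \<delta>) + lam1 * P_ba * d)
        - poisson_less r_h (lam1 * P_ba * (real (Suc i) * d)) * (lam2 * P_br * d * \<delta> / (1 - \<delta>)))))"
    (is "_ = ereal (g * ?L)")
proof -
  have nonneg: "0 \<le> \<delta> ^ \<tau> * mean_sales \<tau>" for \<tau> using assms mean_sales_nonneg[of \<tau>] by simp
  have "(\<integral>\<^sup>+\<omega>. (\<Sum>\<tau>. ennreal (\<delta> ^ \<tau> * real (transactions S d \<tau> \<omega>))) \<partial>M)
    = (\<Sum>\<tau>. \<integral>\<^sup>+\<omega>. ennreal (\<delta> ^ \<tau>) * ennreal (real (transactions S d \<tau> \<omega>)) \<partial>M)"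
    using assms by (simp add: nn_integral_suminf ennreal_mult)
  also have "\<dots> = (\<Sum>\<tau>. ennreal (\<delta> ^ \<tau> * mean_sales \<tau>))"
    using assms by (simp add: nn_integral_cmult expected_transactions ennreal_mult mean_sales_nonneg)
  also have "\<dots> = ennreal ?L"
    by (rule suminf_ennreal_eq[OF nonneg mean_sales_sums[OF assms]])
  finally have "expected_gain M S d \<delta> g = ereal g * enn2ereal (ennreal ?L)"
    unfolding expected_gain_eq[OF assms(1)] by simp
  \<comment> \<open>Needed to read \<open>ennreal ?L\<close> back as the real number
    \<open>?L\<close>, since \<open>ennreal\<close> truncates negative values to
    \<open>0\<close>.\<close>
  moreover have "0 \<le> ?L"
    using sums_le[OF _ sums_zero mean_sales_sums[OF assms]] nonneg by simp
  ultimately show ?thesis by (simp add: enn2ereal_ennreal)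
qed

end

text \<open>The factor \<open>1 / \<delta>\<close> reconciles two conventions: slot \<open>i\<close>
  is discounted by \<open>\<delta> ^ i\<close> in \<open>expected_gain\<close>, but by
  \<open>\<delta> ^ (i + 1)\<close> through the ceiling. The formula is stated for
  \<open>\<delta> < 1\<close> because of the denominator \<open>1 - \<delta>\<close>. The relation
  between the gains covers \<open>\<delta> = 1\<close> too and needs \<open>u \<noteq> 0\<close> for
  the quotient.\<close>

theorem theorem4p3:
  fixes M :: "'a measure" and B S :: "'a \<Rightarrow> real set"
    and d \<theta> T_w lam1 lam2 Q \<beta> p c \<alpha> \<delta> P_ba P_br u :: real
    and r_h :: nat and \<P> :: "real \<Rightarrow> real \<Rightarrow> real" and G_s G_e :: ereal
  assumes d: "0 < d"
    and r_h: "0 < r_h"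
    and \<theta>: "0 < \<theta>" "\<theta> \<le> 1"
    and rates: "0 < lam1" "lam1 < lam2"
    and Q: "0 \<le> Q" "Q \<le> 1"
    and \<beta>: "0 \<le> \<beta>" "\<beta> \<le> 1"
    and p: "0 \<le> p" "p \<le> 1"
    and c: "0 \<le> c" "c \<le> 1"
    and \<alpha>: "0 < \<alpha>" "\<alpha> < 1"
    and \<delta>: "0 < \<delta>" "\<delta> \<le> 1"
    and T_w: "0 < T_w" "T_w / d \<in> \<nat>"
    and \<P>_prob: "\<And>q x. q \<in> {0..1} \<Longrightarrow> x \<in> {0..1} \<Longrightarrow> \<P> q x \<in> {0..1}"
    and \<P>_quality: "\<And>x. x \<in> {0..1} \<Longrightarrow> mono_on {0..1} (\<lambda>q. \<P> q x)"
    and \<P>_price: "\<And>q. q \<in> {0..1} \<Longrightarrow> antimono_on {0..1} (\<lambda>x. \<P> q x)"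
    and P_ba: "P_ba = \<P> (\<beta> * Q) p"
    and P_br: "P_br = \<P> Q p"
    and seller: "honest_seller M B S d r_h \<theta> T_w lam1 lam2 P_ba P_br"
    and u: "u = (1 - \<alpha>) * p - c"
    and G_s: "G_s = expected_gain M S d \<delta> u"
    and G_e: "G_e = expected_gain M S d \<delta> (\<alpha> * p)"
  shows "(\<delta> < 1 \<longrightarrow> G_s = ereal ((1 / \<delta>) *
      ((\<Sum>k = 0..r_h - 1. (lam1 * P_ba * T_w) ^ k / fact k * exp (- lam1 * P_ba * T_w) *
          (LINT t:ordered_times k T_w|lborel_upto k.
             fact k / T_w ^ k * (\<Sum>j = 1..k. u * \<delta> powi \<lceil>t j / d\<rceil>)))
       + (LINT s:{0..T_w}|lborel. LINT t:ordered_times (r_h - 1) s|lborel_upto (r_h - 1).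
            lam1 * P_ba * exp (- lam1 * P_ba * s)
            * ((lam1 * P_ba * s) ^ (r_h - 1) / fact (r_h - 1))
            * (fact (r_h - 1) / s ^ (r_h - 1)) * u
            * ((\<Sum>j = 1..r_h. \<delta> powi \<lceil>(t(r_h := s)) j / d\<rceil>)
               + lam2 * P_br * d * (\<delta> powi (\<lceil>s / d\<rceil> + 1) / (1 - \<delta>))
               + \<delta> powi \<lceil>s / d\<rceil> * (lam1 * P_ba) * (d * of_int \<lceil>s / d\<rceil> - s))))))
    \<and> (u \<noteq> 0 \<longrightarrow> G_e = ereal (\<alpha> * p / u) * G_s)"
proof -
  obtain K :: nat where "T_w / d = real K" using T_w(2) by (auto elim: Nats_cases)
  then have K: "T_w = real K * d" using d by (simp add: field_simps)
  obtain m where m: "r_h = Suc m" using r_h by (cases r_h) auto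
  have "\<beta> * Q \<in> {0..1}" "Q \<in> {0..1}" "p \<in> {0..1}" using Q \<beta> p by (auto intro: mult_le_one)
  then have P: "P_ba \<in> {0..1}" "P_br \<in> {0..1}" using \<P>_prob by (simp_all only: P_ba P_br)
  interpret ramping_seller M B S d r_h \<theta> T_w lam1 lam2 P_ba P_br K
    by (rule ramping_seller.intro[OF seller], unfold_locales) (use d r_h \<theta> rates P K in auto)
  interpret slot_discount \<delta> d
    by unfold_locales (use d \<delta> in auto)
  have ab: "0 \<le> lam1 * P_ba" "0 \<le> lam2 * P_br" using rates P by auto
  show ?thesis
  proof (intro conjI impI)
    assume "\<delta> < 1"
    \<comment> \<open>Multiplying and dividing by \<open>\<delta>\<close> raises each weight
      \<open>\<delta> ^ i\<close> to the \<open>\<delta> ^ Suc i\<close> of the integral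
      side.\<close>
    have "G_s = ereal ((1 / \<delta>) * (u * (\<Sum>i<K. \<delta> ^ Suc i *
        (poisson_less (Suc m) (lam1 * P_ba * (real i * d)) * (lam2 * P_br * d * \<delta> / (1 - \<delta>) + lam1 * P_ba * d)
          - poisson_less (Suc m) (lam1 * P_ba * (real (Suc i) * d)) * (lam2 * P_br * d * \<delta> / (1 - \<delta>))))))"
      unfolding G_s expected_gain_slot_sum[OF \<delta>(1) \<open>\<delta> < 1\<close>] m
      using \<delta>(1) by (simp add: sum_distrib_left mult_ac)
    then show "G_s = ereal ((1 / \<delta>) *
      ((\<Sum>k = 0..r_h - 1. (lam1 * P_ba * T_w) ^ k / fact k * exp (- lam1 * P_ba * T_w) *
          (LINT t:ordered_times k T_w|lborel_upto k.
             fact k / T_w ^ k * (\<Sum>j = 1..k. u * \<delta> powi \<lceil>t j / d\<rceil>)))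
       + (LINT s:{0..T_w}|lborel. LINT t:ordered_times (r_h - 1) s|lborel_upto (r_h - 1).
            lam1 * P_ba * exp (- lam1 * P_ba * s)
            * ((lam1 * P_ba * s) ^ (r_h - 1) / fact (r_h - 1))
            * (fact (r_h - 1) / s ^ (r_h - 1)) * u
            * ((\<Sum>j = 1..r_h. \<delta> powi \<lceil>(t(r_h := s)) j / d\<rceil>)
               + lam2 * P_br * d * (\<delta> powi (\<lceil>s / d\<rceil> + 1) / (1 - \<delta>))
               + \<delta> powi \<lceil>s / d\<rceil> * (lam1 * P_ba) * (d * of_int \<lceil>s / d\<rceil> - s)))))"
      unfolding gain_integrals_eq_slot_sum[OF T_w(1) ab \<open>\<delta> < 1\<close> K, symmetric] m
      by (simp only: discount_def diff_Suc_1 mult_minus_left)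
  next
    assume "u \<noteq> 0"
    then show "G_e = ereal (\<alpha> * p / u) * G_s"
      unfolding G_e G_s expected_gain_eq[OF \<delta>(1)] by (simp add: mult.assoc[symmetric])
  qed
qed

end
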